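(* Let $(\Omega,\Sigma)$ be a standard Borel space and let $Q=BC\cap AC_\infty$. The Burkill-Cesari integral $\partial^+_{\emptyset}$ is a Milnor semivalue on $Q$; that is, $\nu\mapsto\partial^+_{\emptyset}(\nu,\cdot)$ is both a Milnor operator and a semivalue on $Q$.
   Context: A game is a set function $\nu:\Sigma\to\mathbb{R}$ with $\nu(\emptyset)=0$; it is monotone if $\nu(A)\le\nu(B)$ whenever $A\subseteq B$. $NA$ is the space of (finite signed) nonatomic countably additive measures on $\Sigma$, and $NA^+$ its nonnegative elements. $BV$ is the space of games with $\sup\sum_i|\nu(S_i)-\nu(S_{i-1})|<\infty$ over all finite chains $\emptyset=S_0\subset\dots\subset S_m=\Omega$ in $\Sigma$. For games write $\nu\preceq\eta$ if $\eta-\nu$ is monotone. $AC_\infty$ (Lipschitz games) is the space of $\nu\in BV$ such that $-\mu\preceq\nu\preceq\mu$ for some $\mu\in NA^+$. For $E\in\Sigma$, $\Pi(E)$ is the set of finite partitions of $E$ into disjoint elements of $\Sigma$. For $\lambda\in NA^+$ and $D\in\Pi(E)$ put $\delta_\lambda(D)=\max\{\lambda(I):I\in D\}$. A game $\nu$ is $\delta_\lambda$-BC (Burkill-Cesari) integrable if for every $E\in\Sigma$ the finite limit $\partial^+_{\emptyset}(\nu,E):=\lim_{\delta_\lambda(D)\to0,\,D\in\Pi(E)}\sum_{I\in D}\nu(I)$ exists, i.e. for every $\varepsilon>0$ there is $\delta>0$ such that $|\sum_{I\in D}\nu(I)-\partial^+_{\emptyset}(\nu,E)|<\varepsilon$ for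 all $D\in\Pi(E)$ with $\delta_\lambda(D)<\delta$. $BC$ is the space of games that are $\delta_\lambda$-BC integrable for some $\lambda\in NA^+$; the integral is known not to depend on the choice of such $\lambda$. For $\nu\in AC_\infty$ let $D^\nu=\{\lambda\in NA:\nu\preceq\lambda\}$, $D_\nu=\{\lambda\in NA:\lambda\preceq\nu\}$, and let $\nu^*$ be the greatest lower bound of $D^\nu$ and $\nu_*$ the least upper bound of $D_\nu$ in $NA$ with the setwise order $\le$ (these exist). For a linear subspace $NA\subseteq W\subseteq AC_\infty$, a linear operator $\psi:W\to NA$ is a Milnor operator if $\nu_*\le\psi\nu\le\nu^*$ for every $\nu\in W$. $\mathcal G$ is the group of automorphisms of $(\Omega,\Sigma)$ (bijections of $\Omega$ measurable in both directions); for $\vartheta\in\mathcal G$, $(\vartheta_*\nu)(E)=\nu(\vartheta(E))$. A subspace of $BV$ is symmetric if it is invariant under every $\vartheta_*$. A semivalue on a symmetric subspace $W$ of $BV$ is a linear mapping $\varphi:W\to NA$ such that (symmetry) $\vartheta_*(\varphi(\nu))=\varphi(\vartheta_*\nu)$ for all $\vartheta\in\mathcal G$, $\nu\in W$; (positivity) $\varphi(\nu)\ge0$ for every monotone $\nu\in W$; and $\varphi(\nu)=\nu$ for $\nu\in NA\cap W$. *)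

theory Defs
  imports "HOL-Analysis.Analysis" "HOL-Library.Disjoint_Sets" "HOL-Library.Lub_Glb"
begin

text \<open>
  A measurable space is given by a value \<open>M :: 'a measure\<close>, of which only \<open>space M\<close>
  and \<open>sets M\<close> are used.
\<close>

definition standard_borel_space :: "'a measure \<Rightarrow> bool" where
  "standard_borel_space M \<longleftrightarrow>
     (\<exists>X. completely_metrizable_space X \<and> separable_space X \<and>
          topspace X = space M \<and> sets M = sigma_sets (topspace X) {U. openin X U})"

section \<open>Games and measures\<close>

text \<open>
  A real function on \<open>sets M\<close> is represented by its extension by \<open>0\<close> to all sets, so
  that two games are equal as HOL functions iff they agree on \<open>sets M\<close>, and the order
  \<open>\<le>\<close> of HOL functions is the setwise order on \<open>sets M\<close>.
\<close>

type_synonym 'a game = "'a set \<Rightarrow> real"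

definition games :: "'a measure \<Rightarrow> 'a game set" where
  "games M = {\<nu>. \<nu> {} = 0 \<and> (\<forall>A. A \<notin> sets M \<longrightarrow> \<nu> A = 0)}"

definition monotone_game :: "'a measure \<Rightarrow> 'a game \<Rightarrow> bool" where
  "monotone_game M \<nu> \<longleftrightarrow> (\<forall>A\<in>sets M. \<forall>B\<in>sets M. A \<subseteq> B \<longrightarrow> \<nu> A \<le> \<nu> B)"

definition game_le :: "'a measure \<Rightarrow> 'a game \<Rightarrow> 'a game \<Rightarrow> bool" where
  "game_le M \<nu> \<eta> \<longleftrightarrow> monotone_game M (\<lambda>E. \<eta> E - \<nu> E)"

definition signed_measures :: "'a measure \<Rightarrow> 'a game set" where
  "signed_measures M = {\<mu> \<in> games M.
     \<forall>A :: nat \<Rightarrow> 'a set. range A \<subseteq> sets M \<longrightarrow> disjoint_family A \<longrightarrow>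
       (\<lambda>n. \<mu> (A n)) sums \<mu> (\<Union>n. A n)}"

text \<open>
  An atom of a signed measure is a set of nonzero value each of whose measurable subsets has
  value either zero or that of the whole set.
\<close>

definition atom_of :: "'a measure \<Rightarrow> 'a game \<Rightarrow> 'a set \<Rightarrow> bool" where
  "atom_of M \<mu> A \<longleftrightarrow> A \<in> sets M \<and> \<mu> A \<noteq> 0 \<and>
     (\<forall>B\<in>sets M. B \<subseteq> A \<longrightarrow> \<mu> B = 0 \<or> \<mu> B = \<mu> A)"

definition NA :: "'a measure \<Rightarrow> 'a game set" where
  "NA M = {\<mu> \<in> signed_measures M. \<nexists>A. atom_of M \<mu> A}"

definition NA_pos :: "'a measure \<Rightarrow> 'a game set" where
  "NA_pos M = {\<mu> \<in> NA M. \<forall>E\<in>sets M. 0 \<le> \<mu> E}"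

definition BV :: "'a measure \<Rightarrow> 'a game set" where
  "BV M = {\<nu> \<in> games M.
     bdd_above {(\<Sum>i<m. \<bar>\<nu> (S (Suc i)) - \<nu> (S i)\<bar>) | (S :: nat \<Rightarrow> 'a set) m.
       S 0 = {} \<and> S m = space M \<and> (\<forall>i\<le>m. S i \<in> sets M) \<and> (\<forall>i<m. S i \<subseteq> S (Suc i))}}"

definition AC_inf :: "'a measure \<Rightarrow> 'a game set" where
  "AC_inf M = {\<nu> \<in> BV M. \<exists>\<mu>\<in>NA_pos M. game_le M (\<lambda>E. - \<mu> E) \<nu> \<and> game_le M \<nu> \<mu>}"

section \<open>The Burkill-Cesari integral\<close>

definition partitions :: "'a measure \<Rightarrow> 'a set \<Rightarrow> 'a set set set" where
  "partitions M E = {D. finite D \<and> D \<subseteq> sets M \<and> partition_on E D}"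

text \<open>
  The inserted \<open>0\<close> matters only for the empty partition of the empty set: all other values
  over which the maximum is taken are nonnegative.
\<close>

definition mesh :: "'a game \<Rightarrow> 'a set set \<Rightarrow> real" where
  "mesh \<kappa> D = Max (insert 0 (\<kappa> ` D))"

definition has_BC_limit :: "'a measure \<Rightarrow> 'a game \<Rightarrow> 'a game \<Rightarrow> 'a set \<Rightarrow> real \<Rightarrow> bool" where
  "has_BC_limit M \<kappa> \<nu> E l \<longleftrightarrow>
     (\<forall>\<epsilon>>0. \<exists>\<delta>>0. \<forall>D\<in>partitions M E. mesh \<kappa> D < \<delta> \<longrightarrow> \<bar>(\<Sum>I\<in>D. \<nu> I) - l\<bar> < \<epsilon>)"

definition BC_integrable :: "'a measure \<Rightarrow> 'a game \<Rightarrow> 'a game \<Rightarrow> bool" where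
  "BC_integrable M \<kappa> \<nu> \<longleftrightarrow> (\<forall>E\<in>sets M. \<exists>l. has_BC_limit M \<kappa> \<nu> E l)"

definition BC :: "'a measure \<Rightarrow> 'a game set" where
  "BC M = {\<nu> \<in> games M. \<exists>\<kappa>\<in>NA_pos M. BC_integrable M \<kappa> \<nu>}"

text \<open>
  The limit does not depend on the choice of \<open>\<kappa>\<close> among the elements of \<open>NA_pos M\<close> for which
  the game is integrable, so the description below is proper for every game in \<open>BC M\<close>.
\<close>

definition BC_integral :: "'a measure \<Rightarrow> 'a game \<Rightarrow> 'a game" where
  "BC_integral M \<nu> = (\<lambda>E. if E \<in> sets M
     then THE l. \<exists>\<kappa>\<in>NA_pos M. BC_integrable M \<kappa> \<nu> \<and> has_BC_limit M \<kappa> \<nu> E l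
     else 0)"

section \<open>Milnor operators and semivalues\<close>

definition game_subspace :: "'a game set \<Rightarrow> bool" where
  "game_subspace W \<longleftrightarrow> (\<lambda>E. 0) \<in> W \<and>
     (\<forall>\<nu>\<in>W. \<forall>\<eta>\<in>W. (\<lambda>E. \<nu> E + \<eta> E) \<in> W) \<and>
     (\<forall>c. \<forall>\<nu>\<in>W. (\<lambda>E. c * \<nu> E) \<in> W)"

definition linear_to_NA :: "'a measure \<Rightarrow> 'a game set \<Rightarrow> ('a game \<Rightarrow> 'a game) \<Rightarrow> bool" where
  "linear_to_NA M W \<psi> \<longleftrightarrow> \<psi> ` W \<subseteq> NA M \<and>
     (\<forall>\<nu>\<in>W. \<forall>\<eta>\<in>W. \<psi> (\<lambda>E. \<nu> E + \<eta> E) = (\<lambda>E. \<psi> \<nu> E + \<psi> \<eta> E)) \<and>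
     (\<forall>c. \<forall>\<nu>\<in>W. \<psi> (\<lambda>E. c * \<nu> E) = (\<lambda>E. c * \<psi> \<nu> E))"

definition upper_measure :: "'a measure \<Rightarrow> 'a game \<Rightarrow> 'a game" where
  "upper_measure M \<nu> = (THE \<mu>. isGlb (NA M) {\<kappa> \<in> NA M. game_le M \<nu> \<kappa>} \<mu>)"

definition lower_measure :: "'a measure \<Rightarrow> 'a game \<Rightarrow> 'a game" where
  "lower_measure M \<nu> = (THE \<mu>. isLub (NA M) {\<kappa> \<in> NA M. game_le M \<kappa> \<nu>} \<mu>)"

definition Milnor_operator :: "'a measure \<Rightarrow> 'a game set \<Rightarrow> ('a game \<Rightarrow> 'a game) \<Rightarrow> bool" where
  "Milnor_operator M W \<psi> \<longleftrightarrow>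
     game_subspace W \<and> NA M \<subseteq> W \<and> W \<subseteq> AC_inf M \<and> linear_to_NA M W \<psi> \<and>
     (\<forall>\<nu>\<in>W. lower_measure M \<nu> \<le> \<psi> \<nu> \<and> \<psi> \<nu> \<le> upper_measure M \<nu>)"

definition automorphisms :: "'a measure \<Rightarrow> ('a \<Rightarrow> 'a) set" where
  "automorphisms M = {\<theta>. bij_betw \<theta> (space M) (space M) \<and> \<theta> \<in> measurable M M \<and>
     the_inv_into (space M) \<theta> \<in> measurable M M}"

definition game_transform :: "'a measure \<Rightarrow> ('a \<Rightarrow> 'a) \<Rightarrow> 'a game \<Rightarrow> 'a game" where
  "game_transform M \<theta> \<nu> = (\<lambda>E. if E \<in> sets M then \<nu> (\<theta> ` E) else 0)"

definition symmetric_subspace :: "'a measure \<Rightarrow> 'a game set \<Rightarrow> bool" where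
  "symmetric_subspace M W \<longleftrightarrow> game_subspace W \<and> W \<subseteq> BV M \<and>
     (\<forall>\<theta>\<in>automorphisms M. \<forall>\<nu>\<in>W. game_transform M \<theta> \<nu> \<in> W)"

definition semivalue :: "'a measure \<Rightarrow> 'a game set \<Rightarrow> ('a game \<Rightarrow> 'a game) \<Rightarrow> bool" where
  "semivalue M W \<phi> \<longleftrightarrow>
     symmetric_subspace M W \<and> linear_to_NA M W \<phi> \<and>
     (\<forall>\<theta>\<in>automorphisms M. \<forall>\<nu>\<in>W. game_transform M \<theta> (\<phi> \<nu>) = \<phi> (game_transform M \<theta> \<nu>)) \<and>
     (\<forall>\<nu>\<in>W. monotone_game M \<nu> \<longrightarrow> (\<forall>E\<in>sets M. 0 \<le> \<phi> \<nu> E)) \<and>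
     (\<forall>\<nu>\<in>NA M \<inter> W. \<phi> \<nu> = \<nu>)"

end

theory Submission
  imports Defs
begin

text \<open>
  In a standard Borel space a signed measure is nonatomic iff it vanishes on points, and every
  nonatomic measure admits partitions of arbitrarily small mesh, so the Burkill-Cesari limit is
  taken along a proper filter. The integral of a Lipschitz game \<open>\<nu>\<close> is finitely additive and
  dominated by the Lipschitz bound \<open>\<mu>\<close> of \<open>\<nu>\<close>; since \<open>\<mu>\<close> is nonatomic and countably additive,
  so is the integral. If a measure \<open>\<eta>\<close> satisfies \<open>\<nu> \<preceq> \<eta>\<close>, all approximating sums over partitions
  of \<open>E\<close> are at most \<open>\<eta>(E)\<close>, hence the integral lies below every majorant and thus below \<open>\<nu>\<^sup>*\<close>;
  dually for \<open>\<nu>\<^sub>*\<close>. The bounds exist because majorants can be spliced along measurable sets, so that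
  their pointwise infimum is already additive.
\<close>

section \<open>Signed measures\<close>

text \<open>Three obstacles shape the argument. Measures are real set functions on
  \<open>sets M\<close> and atoms are defined through signed values, so that closure of
  \<open>NA M\<close> under sums cannot be read off from its definition; the criterion on points
  turns \<open>NA M\<close> into an evident linear space. Next, every game of \<open>BC M\<close>
  brings its own control measure. Enlarging a control keeps every limit, so the sum of two controls
  serves both games; this gives uniqueness of the integral as well as its linearity. Finally, a
  signed nonatomic measure counts as a Lipschitz game only if some element of
  \<open>NA_pos M\<close> dominates it, which calls for a Jordan decomposition and hence for the
  boundedness of signed measures. Since \<open>BC_integral\<close>, \<open>upper_measure\<close> and
  \<open>lower_measure\<close> are definite descriptions, existence and uniqueness have to come
  before any inequality about them.\<close>

lemma gamesD:
  assumes "f \<in> games M"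
  shows "f {} = 0" and "E \<notin> sets M \<Longrightarrow> f E = 0"
  using assms by (auto simp: games_def)

text \<open>\<open>isGlb\<close> and \<open>isLub\<close> refer to the order on all sets; as games
  vanish off \<open>sets M\<close>, that order is tested on measurable sets.\<close>

lemma games_le_iff:
  assumes "f \<in> games M" "g \<in> games M"
  shows "f \<le> g \<longleftrightarrow> (\<forall>E\<in>sets M. f E \<le> g E)"
proof -
  have "f E \<le> g E" if "E \<notin> sets M" for E
    using that assms by (simp add: gamesD(2))
  then show ?thesis
    unfolding le_fun_def by blast
qed

text \<open>Isolated because the integral, the positive variation and the infimum of majorants are
  each shown to be finitely additive first, countable additivity being derived afterwards.\<close>

definition finitely_additive :: "'a measure \<Rightarrow> 'a game \<Rightarrow> bool" where
  "finitely_additive M f \<longleftrightarrow>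
     (\<forall>A\<in>sets M. \<forall>B\<in>sets M. A \<inter> B = {} \<longrightarrow> f (A \<union> B) = f A + f B)"

lemma finitely_additiveD:
  "finitely_additive M f \<Longrightarrow> A \<in> sets M \<Longrightarrow> B \<in> sets M \<Longrightarrow> A \<inter> B = {} \<Longrightarrow> f (A \<union> B) = f A + f B"
  by (auto simp: finitely_additive_def)

lemma finitely_additive_Diff:
  assumes "finitely_additive M f" "A \<in> sets M" "B \<in> sets M" "B \<subseteq> A"
  shows "f (A - B) = f A - f B"
  using finitely_additiveD[OF assms(1), of B "A - B"] assms(2-4)
  by (auto simp: Un_absorb1)

lemma finitely_additive_sum:
  assumes "finitely_additive M f" "f {} = 0" "finite I" "\<And>i. i \<in> I \<Longrightarrow> A i \<in> sets M"
    and "disjoint_family_on A I"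
  shows "f (\<Union>i\<in>I. A i) = (\<Sum>i\<in>I. f (A i))"
  using assms(3-5)
proof (induction I rule: finite_induct)
  case (insert i I)
  have "f (A i \<union> (\<Union>j\<in>I. A j)) = f (A i) + f (\<Union>j\<in>I. A j)"
    using insert by (intro finitely_additiveD[OF assms(1)]) (auto simp: disjoint_family_on_def)
  then show ?case
    using insert by (auto simp: disjoint_family_on_def)
qed (simp add: assms(2))

lemma finitely_additive_partition:
  assumes "finitely_additive M f" "f {} = 0" "D \<in> partitions M E"
  shows "(\<Sum>I\<in>D. f I) = f E"
proof -
  have D: "finite D" "D \<subseteq> sets M" "\<Union>D = E" "disjoint D"
    using assms(3) by (auto simp: partitions_def partition_on_def)
  have "f (\<Union>I\<in>D. I) = (\<Sum>I\<in>D. f I)"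
    using D by (intro finitely_additive_sum[OF assms(1,2)]) (auto simp: disjoint_def disjoint_family_on_def)
  then show ?thesis
    using D by simp
qed

lemma signed_measures_games: "\<mu> \<in> signed_measures M \<Longrightarrow> \<mu> \<in> games M"
  by (simp add: signed_measures_def)

lemma signed_measures_sums:
  "\<mu> \<in> signed_measures M \<Longrightarrow> range A \<subseteq> sets M \<Longrightarrow> disjoint_family A
    \<Longrightarrow> (\<lambda>n. \<mu> (A n)) sums \<mu> (\<Union>n. A n)" for A :: "nat \<Rightarrow> 'a set"
  by (simp add: signed_measures_def)

lemma signed_measures_additive:
  assumes "\<mu> \<in> signed_measures M"
  shows "finitely_additive M \<mu>"
  unfolding finitely_additive_def
proof (intro ballI impI)
  fix A B assume AB: "A \<in> sets M" "B \<in> sets M" "A \<inter> B = {}"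
  have 0: "\<mu> {} = 0"
    using assms signed_measures_games gamesD(1) by blast
  have "(\<lambda>n. \<mu> (binaryset A B n)) sums \<mu> (\<Union>n. binaryset A B n)"
    using AB by (intro signed_measures_sums[OF assms])
      (auto simp: range_binaryset_eq disjoint_family_on_def binaryset_def)
  moreover have "(\<lambda>n. \<mu> (binaryset A B n)) sums (\<mu> A + \<mu> B)"
    using binaryset_sums[where f = \<mu>, OF 0] by blast
  ultimately show "\<mu> (A \<union> B) = \<mu> A + \<mu> B"
    by (metis UN_binaryset_eq sums_unique2)
qed

lemma signed_measures_add:
  assumes "\<mu> \<in> signed_measures M" "\<nu> \<in> signed_measures M"
  shows "(\<lambda>E. \<mu> E + \<nu> E) \<in> signed_measures M"
  using assms by (auto simp: signed_measures_def games_def intro!: sums_add)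

lemma signed_measures_cmult:
  assumes "\<mu> \<in> signed_measures M"
  shows "(\<lambda>E. c * \<mu> E) \<in> signed_measures M"
  using assms by (auto simp: signed_measures_def games_def intro!: sums_mult)

text \<open>Continuity from above: the rings \<open>A n - A (Suc n)\<close> are disjoint and exhaust
  \<open>A 0\<close> minus the intersection, so countable additivity becomes a telescoping
  series.\<close>

lemma signed_measures_decseq:
  fixes A :: "nat \<Rightarrow> 'a set"
  assumes \<mu>: "\<mu> \<in> signed_measures M" and A: "range A \<subseteq> sets M" "decseq A"
  shows "(\<lambda>n. \<mu> (A n)) \<longlonglongrightarrow> \<mu> (\<Inter>n. A n)"
proof -
  note add = signed_measures_additive[OF \<mu>]
  have A': "A n \<in> sets M" for n
    using A by auto
  have I: "(\<Inter>n. A n) \<in> sets M"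
    using A by auto
  let ?D = "\<lambda>n. A n - A (Suc n)"
  have dec: "A n \<subseteq> A m" if "m \<le> n" for m n
    using A(2) that by (auto simp: decseq_def)
  have disj: "disjoint_family ?D"
  proof -
    have "?D m \<inter> ?D n = {}" if "m < n" for m n
      using dec[of "Suc m" n] that by auto
    then show ?thesis
      unfolding disjoint_family_on_def by (metis Int_commute nat_neq_iff)
  qed
  have "x \<in> (\<Union>n. ?D n)" if x: "x \<in> A 0" "x \<notin> A m" for x m
  proof (rule ccontr)
    assume "x \<notin> (\<Union>n. ?D n)"
    then have "x \<in> A n" for n
      by (induction n) (use x in auto)
    then show False
      using x by blast
  qed
  then have "A 0 - (\<Inter>n. A n) \<subseteq> (\<Union>n. ?D n)"
    by blast
  then have "(\<Union>n. ?D n) = A 0 - (\<Inter>n. A n)"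
    using dec[of 0] by blast
  then have "(\<lambda>n. \<mu> (?D n)) sums (\<mu> (A 0) - \<mu> (\<Inter>n. A n))"
    using signed_measures_sums[OF \<mu> _ disj] A' finitely_additive_Diff[OF add A'[of 0] I]
      INT_lower[of 0 UNIV A]
    by (auto simp: image_subset_iff)
  moreover have "\<mu> (?D n) = \<mu> (A n) - \<mu> (A (Suc n))" for n
    using finitely_additive_Diff[OF add A' A'] dec[of n "Suc n"] by auto
  ultimately have "(\<lambda>n. \<Sum>i<n. \<mu> (A i) - \<mu> (A (Suc i))) \<longlonglongrightarrow> \<mu> (A 0) - \<mu> (\<Inter>n. A n)"
    by (simp add: sums_def)
  then have "(\<lambda>n. \<mu> (A 0) - \<mu> (A n)) \<longlonglongrightarrow> \<mu> (A 0) - \<mu> (\<Inter>n. A n)"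
    by (simp add: sum_lessThan_telescope'[where f = "\<lambda>i. \<mu> (A i)"])
  from tendsto_diff[OF tendsto_const[of "\<mu> (A 0)"] this] show ?thesis
    by simp
qed

lemma signed_measures_mono:
  assumes "\<mu> \<in> signed_measures M" "\<forall>E\<in>sets M. 0 \<le> \<mu> E" "A \<in> sets M" "B \<in> sets M" "A \<subseteq> B"
  shows "\<mu> A \<le> \<mu> B"
  using finitely_additive_Diff[OF signed_measures_additive[OF assms(1)] assms(4,3,5)] assms
  by (metis diff_ge_0_iff_ge sets.Diff)

text \<open>If the values were unbounded, one could cut off pieces again and again, each of absolute
  value at least 1, such that the rest still has subsets of unbounded value. The pieces are
  disjoint, so their values would have to tend to 0.\<close>

lemma signed_measures_bounded:
  assumes \<mu>: "\<mu> \<in> signed_measures M"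
  shows "\<exists>K. \<forall>B\<in>sets M. \<bar>\<mu> B\<bar> \<le> K"
proof (rule ccontr)
  assume unbounded: "\<not> ?thesis"
  note add = signed_measures_additive[OF \<mu>]
  define bad where "bad E \<longleftrightarrow> E \<in> sets M \<and> (\<forall>K. \<exists>B\<in>sets M. B \<subseteq> E \<and> K < \<bar>\<mu> B\<bar>)" for E
  have step: "\<exists>E'. bad E' \<and> E' \<subseteq> E \<and> 1 \<le> \<bar>\<mu> (E - E')\<bar>" if E: "bad E" for E
  proof -
    \<comment> \<open>With this threshold both \<open>\<mu> B\<close> and
      \<open>\<mu> (E - B) = \<mu> E - \<mu> B\<close> exceed 1 in absolute value, so either half
      may be the one that is cut off.\<close>
    obtain B where B: "B \<in> sets M" "B \<subseteq> E" "\<bar>\<mu> E\<bar> + 1 < \<bar>\<mu> B\<bar>"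
      using E unfolding bad_def by blast
    have EM: "E \<in> sets M"
      using E by (simp add: bad_def)
    have d: "\<mu> (E - B) = \<mu> E - \<mu> B"
      using finitely_additive_Diff[OF add EM] B by blast
    have "bad B \<or> bad (E - B)"
    proof (rule ccontr)
      assume "\<not> ?thesis"
      then have "\<exists>K. \<forall>C\<in>sets M. C \<subseteq> B \<longrightarrow> \<bar>\<mu> C\<bar> \<le> K"
        and "\<exists>L. \<forall>C\<in>sets M. C \<subseteq> E - B \<longrightarrow> \<bar>\<mu> C\<bar> \<le> L"
        using B(1) EM by (simp_all add: bad_def not_less)
      then obtain K L where K: "\<forall>C\<in>sets M. C \<subseteq> B \<longrightarrow> \<bar>\<mu> C\<bar> \<le> K"
        and L: "\<forall>C\<in>sets M. C \<subseteq> E - B \<longrightarrow> \<bar>\<mu> C\<bar> \<le> L"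
        by metis
      have "\<bar>\<mu> C\<bar> \<le> K + L" if C: "C \<in> sets M" "C \<subseteq> E" for C
      proof -
        have "\<mu> ((C \<inter> B) \<union> (C - B)) = \<mu> (C \<inter> B) + \<mu> (C - B)"
          using C B by (intro finitely_additiveD[OF add]) auto
        moreover have "\<bar>\<mu> (C \<inter> B)\<bar> \<le> K" "\<bar>\<mu> (C - B)\<bar> \<le> L"
          using C B K L by (simp_all add: Diff_mono)
        ultimately show ?thesis
          by (simp add: Int_Diff_Un)
      qed
      with E show False
        unfolding bad_def by (meson not_le)
    qed
    then show ?thesis
    proof
      assume "bad B"
      then show ?thesis
        using B d by (intro exI[of _ B]) auto
    next
      assume "bad (E - B)"
      moreover have "E - (E - B) = B"
        using B by auto
      ultimately show ?thesis
        using B by (intro exI[of _ "E - B"]) auto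
    qed
  qed
  have "bad (space M)"
    unfolding bad_def using unbounded sets.sets_into_space by (meson not_le sets.top)
  then have "\<exists>E. \<forall>n. bad (E n) \<and> E (Suc n) \<subseteq> E n \<and> 1 \<le> \<bar>\<mu> (E n - E (Suc n))\<bar>"
    by (intro dependent_nat_choice) (auto intro: step)
  then obtain E where E: "\<And>n. bad (E n)" "\<And>n. E (Suc n) \<subseteq> E n \<and> 1 \<le> \<bar>\<mu> (E n - E (Suc n))\<bar>"
    by metis
  have dec: "E n \<subseteq> E m" if "m \<le> n" for m n
    using E(2) that by (metis lift_Suc_antimono_le)
  have "(E m - E (Suc m)) \<inter> (E n - E (Suc n)) = {}" if "m < n" for m n
    using dec[of "Suc m" n] that by auto
  then have "disjoint_family (\<lambda>n. E n - E (Suc n))"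
    unfolding disjoint_family_on_def by (metis Int_commute nat_neq_iff)
  moreover have "range (\<lambda>n. E n - E (Suc n)) \<subseteq> sets M"
    using E(1) by (auto simp: bad_def)
  ultimately have "(\<lambda>n. \<mu> (E n - E (Suc n))) \<longlonglongrightarrow> 0"
    using signed_measures_sums[OF \<mu>] by (intro summable_LIMSEQ_zero sums_summable)
  then have "(\<lambda>n. \<bar>\<mu> (E n - E (Suc n))\<bar>) \<longlonglongrightarrow> 0"
    by (simp add: tendsto_rabs_zero)
  from LIMSEQ_le_const[OF this, of 1] E(2) show False
    by auto
qed

text \<open>By additivity the error of a partial sum is the value of \<open>f\<close> on the
  remaining tail of the union; \<open>\<mu>\<close> bounds it there, and the tails of
  \<open>\<mu>\<close> tend to 0.\<close>

lemma signed_measure_of_dominated: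
  assumes f: "f \<in> games M" "finitely_additive M f"
    and \<mu>: "\<mu> \<in> signed_measures M" and le: "\<And>E. E \<in> sets M \<Longrightarrow> \<bar>f E\<bar> \<le> \<mu> E"
  shows "f \<in> signed_measures M"
  unfolding signed_measures_def
proof safe
  fix A :: "nat \<Rightarrow> 'a set"
  assume A: "range A \<subseteq> sets M" "disjoint_family A"
  let ?U = "\<Union>n. A n" and ?F = "\<lambda>n. \<Union>i<n. A i"
  have F: "?F n \<in> sets M" "?U \<in> sets M" "?F n \<subseteq> ?U" for n
    using A by auto
  have part: "g (?U - ?F n) = g ?U - (\<Sum>i<n. g (A i))"
    if "g \<in> games M" "finitely_additive M g" for g n
    using finitely_additive_Diff[OF that(2) F(2,1,3)]
      finitely_additive_sum[OF that(2) gamesD(1)[OF that(1)], of "{..<n}" A] A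
    by (auto intro: disjoint_family_on_mono)
  have "\<bar>f ?U - (\<Sum>i<n. f (A i))\<bar> \<le> \<mu> ?U - (\<Sum>i<n. \<mu> (A i))" for n
    using le[of "?U - ?F n"] F
    unfolding part[OF f] part[OF signed_measures_games[OF \<mu>] signed_measures_additive[OF \<mu>]]
    by blast
  moreover have "(\<lambda>n. \<mu> ?U - (\<Sum>i<n. \<mu> (A i))) \<longlonglongrightarrow> \<mu> ?U - \<mu> ?U"
    using signed_measures_sums[OF \<mu> A] by (intro tendsto_diff tendsto_const) (simp add: sums_def)
  ultimately have "(\<lambda>n. f ?U - (\<Sum>i<n. f (A i))) \<longlonglongrightarrow> 0"
    by (intro Lim_null_comparison[of "\<lambda>n. f ?U - (\<Sum>i<n. f (A i))"]) auto
  from tendsto_diff[OF tendsto_const[of "f ?U"] this]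
  show "(\<lambda>n. f (A n)) sums f ?U"
    by (simp add: sums_def)
qed (use f in auto)

section \<open>The positive part in the Jordan decomposition\<close>

definition positive_variation :: "'a measure \<Rightarrow> 'a game \<Rightarrow> 'a game" where
  "positive_variation M \<mu> = (\<lambda>E. if E \<in> sets M then Sup {\<mu> B | B. B \<in> sets M \<and> B \<subseteq> E} else 0)"

context
  fixes M :: "'a measure" and \<mu> :: "'a game"
  assumes \<mu>: "\<mu> \<in> signed_measures M"
begin

text \<open>The place where boundedness enters: a real supremum is an upper bound only when the set
  of values is bounded above.\<close>

lemma positive_variation_upper:
  assumes "E \<in> sets M" "B \<in> sets M" "B \<subseteq> E"
  shows "\<mu> B \<le> positive_variation M \<mu> E"
proof -
  obtain K where "\<forall>B\<in>sets M. \<bar>\<mu> B\<bar> \<le> K"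
    using signed_measures_bounded[OF \<mu>] by blast
  then have "bdd_above {\<mu> B | B. B \<in> sets M \<and> B \<subseteq> E}"
    by (intro bdd_aboveI[of _ K]) (auto dest!: bspec)
  then show ?thesis
    using assms by (auto simp: positive_variation_def intro!: cSup_upper)
qed

lemma positive_variation_least:
  assumes "E \<in> sets M" "\<And>B. B \<in> sets M \<Longrightarrow> B \<subseteq> E \<Longrightarrow> \<mu> B \<le> c"
  shows "positive_variation M \<mu> E \<le> c"
  using assms unfolding positive_variation_def by (auto intro!: cSup_least)

lemma positive_variation_nonneg: "E \<in> sets M \<Longrightarrow> 0 \<le> positive_variation M \<mu> E"
  using positive_variation_upper[of E "{}"] gamesD(1)[OF signed_measures_games[OF \<mu>]] by simp

lemma positive_variation_games: "positive_variation M \<mu> \<in> games M"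
proof -
  have "positive_variation M \<mu> {} = 0"
    using positive_variation_nonneg[of "{}"] positive_variation_least[of "{}" 0]
      gamesD(1)[OF signed_measures_games[OF \<mu>]] by (auto intro!: antisym)
  then show ?thesis
    by (auto simp: games_def positive_variation_def)
qed

lemma positive_variation_additive: "finitely_additive M (positive_variation M \<mu>)"
  unfolding finitely_additive_def
proof (intro ballI impI)
  note add = signed_measures_additive[OF \<mu>]
  let ?P = "positive_variation M \<mu>"
  fix A B assume AB: "A \<in> sets M" "B \<in> sets M" "A \<inter> B = {}"
  show "?P (A \<union> B) = ?P A + ?P B"
  proof (rule antisym)
    show "?P (A \<union> B) \<le> ?P A + ?P B"
    proof (rule positive_variation_least)
      fix C assume C: "C \<in> sets M" "C \<subseteq> A \<union> B"
      then have "\<mu> ((C \<inter> A) \<union> (C \<inter> B)) = \<mu> (C \<inter> A) + \<mu> (C \<inter> B)"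
        using AB by (intro finitely_additiveD[OF add]) auto
      moreover have "(C \<inter> A) \<union> (C \<inter> B) = C"
        using C by auto
      ultimately show "\<mu> C \<le> ?P A + ?P B"
        using positive_variation_upper[of A "C \<inter> A"] positive_variation_upper[of B "C \<inter> B"] AB C
        by auto
    qed (use AB in auto)
    \<comment> \<open>The two suprema are taken one after the other: over subsets of
      \<open>A\<close> with \<open>C\<close> fixed, then over \<open>C\<close>.\<close>
    have "?P A \<le> ?P (A \<union> B) - \<mu> C" if C: "C \<in> sets M" "C \<subseteq> B" for C
    proof (rule positive_variation_least)
      fix D assume D: "D \<in> sets M" "D \<subseteq> A"
      have "\<mu> (D \<union> C) = \<mu> D + \<mu> C"
        using AB C D by (intro finitely_additiveD[OF add]) auto
      then show "\<mu> D \<le> ?P (A \<union> B) - \<mu> C"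
        using positive_variation_upper[of "A \<union> B" "D \<union> C"] AB C D
        by (simp add: le_diff_eq sup.coboundedI1 sup.coboundedI2)
    qed (use AB in auto)
    then have "?P B \<le> ?P (A \<union> B) - ?P A"
      using AB by (intro positive_variation_least) (auto simp: algebra_simps)
    then show "?P A + ?P B \<le> ?P (A \<union> B)"
      by simp
  qed
qed

text \<open>Finite additivity bounds the partial sums, which yields convergence and one inequality.
  For the other, a subset of the union is cut along the sets \<open>A n\<close> and countable
  additivity of \<open>\<mu>\<close> applies.\<close>

lemma positive_variation_signed_measures: "positive_variation M \<mu> \<in> signed_measures M"
  unfolding signed_measures_def
proof safe
  let ?P = "positive_variation M \<mu>"
  show "?P \<in> games M"
    by (rule positive_variation_games)
  note add = positive_variation_additive
  fix A :: "nat \<Rightarrow> 'a set"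
  assume A: "range A \<subseteq> sets M" "disjoint_family A"
  let ?U = "\<Union>n. A n"
  have U: "?U \<in> sets M"
    using A by auto
  have nonneg: "0 \<le> ?P (A n)" for n
    using A positive_variation_nonneg by blast
  have partial: "(\<Sum>i<n. ?P (A i)) \<le> ?P ?U" for n
  proof -
    have "(\<Sum>i<n. ?P (A i)) = ?P (\<Union>i<n. A i)"
      using A by (intro finitely_additive_sum[OF add gamesD(1)[OF positive_variation_games], symmetric])
        (auto intro: disjoint_family_on_mono)
    also have "\<dots> \<le> ?P ?U"
    proof (rule positive_variation_least)
      fix B assume "B \<in> sets M" "B \<subseteq> (\<Union>i<n. A i)"
      then show "\<mu> B \<le> ?P ?U"
        using U by (intro positive_variation_upper) auto
    qed (use A in auto)
    finally show ?thesis .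
  qed
  have summable: "summable (\<lambda>n. ?P (A n))"
    using nonneg partial by (intro summableI_nonneg_bounded)
  have "?P ?U \<le> (\<Sum>n. ?P (A n))"
  proof (rule positive_variation_least[OF U])
    fix B assume B: "B \<in> sets M" "B \<subseteq> ?U"
    have "(\<lambda>n. \<mu> (B \<inter> A n)) sums \<mu> (\<Union>n. B \<inter> A n)"
      using A B by (intro signed_measures_sums[OF \<mu>]) (auto simp: disjoint_family_on_def)
    moreover have "(\<Union>n. B \<inter> A n) = B"
      using B by auto
    moreover have "\<mu> (B \<inter> A n) \<le> ?P (A n)" for n
      using A B by (intro positive_variation_upper) auto
    ultimately show "\<mu> B \<le> (\<Sum>n. ?P (A n))"
      using sums_le[OF _ _ summable_sums[OF summable], of "\<lambda>n. \<mu> (B \<inter> A n)"] by auto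
  qed
  moreover have "(\<Sum>n. ?P (A n)) \<le> ?P ?U"
    using summable partial by (intro suminf_le_const)
  ultimately show "(\<lambda>n. ?P (A n)) sums ?P ?U"
    using summable by (simp add: sums_iff)
qed

end

section \<open>Nonatomic measures on countably separated spaces\<close>

text \<open>Replaces the topology by countably many measurable sets that tell points apart.
  Separation is asked for ordered pairs, so within \<open>space M\<close> each point is the
  intersection of the \<open>B n\<close> that contain it.\<close>

locale countably_separated =
  fixes M :: "'a measure" and B :: "nat \<Rightarrow> 'a set"
  assumes B_sets: "B n \<in> sets M"
    and separating: "x \<in> space M \<Longrightarrow> y \<in> space M \<Longrightarrow> x \<noteq> y \<Longrightarrow> \<exists>n. x \<in> B n \<and> y \<notin> B n"

lemma standard_borel_countably_separated:
  assumes "standard_borel_space M"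
  shows "\<exists>B. countably_separated M B"
proof -
  obtain X where X: "completely_metrizable_space X" "separable_space X" "topspace X = space M"
    "sets M = sigma_sets (topspace X) {U. openin X U}"
    using assms unfolding standard_borel_space_def by blast
  obtain S d where S: "Metric_space S d" "X = Metric_space.mtopology S d"
    using completely_metrizable_imp_metrizable_space[OF X(1)] unfolding metrizable_space_def by blast
  interpret Metric_space S d
    by (rule S)
  obtain C where C: "countable C" "C \<subseteq> S" "mtopology closure_of C = S"
    using X(2) S by (auto simp: separable_space_def)
  have open_sets: "U \<in> sets M" if "openin mtopology U" for U
    using that X(4) S by (auto intro: sigma_sets.Basic)
  \<comment> \<open>Balls of radius \<open>1 / (n + 1)\<close> around a countable dense set. The
    empty set is added so that \<open>from_nat_into\<close> enumerates a nonempty family even for an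
    empty space.\<close>
  define \<B> where "\<B> = insert {} ((\<lambda>(c, n). mball c (inverse (real (Suc n)))) ` (C \<times> UNIV))"
  have \<B>: "countable \<B>" "\<B> \<noteq> {}"
    using C by (auto simp: \<B>_def)
  have "countably_separated M (from_nat_into \<B>)"
  proof
    show "from_nat_into \<B> n \<in> sets M" for n
      using from_nat_into[OF \<B>(2), of n] by (auto simp: \<B>_def intro!: open_sets)
    fix x y assume xy: "x \<in> space M" "y \<in> space M" "x \<noteq> y"
    then have xyS: "x \<in> S" "y \<in> S"
      using X S by auto
    then have "0 < d x y / 2"
      using xy by simp
    \<comment> \<open>Two points of one ball of this radius are less than \<open>d x y\<close>
      apart, so a ball that contains \<open>x\<close> misses \<open>y\<close>.\<close>
    then obtain n where n: "inverse (real (Suc n)) < d x y / 2"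
      using reals_Archimedean by blast
    have "\<forall>r>0. \<exists>c\<in>C. c \<in> mball x r"
      using xyS C(3) unfolding metric_closure_of by blast
    then obtain c where c: "c \<in> C" "c \<in> mball x (inverse (real (Suc n)))"
      by (metis inverse_positive_iff_positive of_nat_0_less_iff zero_less_Suc)
    let ?b = "mball c (inverse (real (Suc n)))"
    have "x \<in> ?b"
      using c by (simp add: commute)
    moreover have "y \<notin> ?b"
      using triangle[of x c y] c xyS n by auto
    moreover have "?b \<in> \<B>"
      using c by (auto simp: \<B>_def)
    ultimately show "\<exists>n. x \<in> from_nat_into \<B> n \<and> y \<notin> from_nat_into \<B> n"
      using from_nat_into_surj[OF \<B>(1)] by metis
  qed
  then show ?thesis
    by blast
qed

context countably_separated
begin

lemma singleton_sets:
  assumes "x \<in> space M"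
  shows "{x} \<in> sets M"
proof -
  have "{x} = space M \<inter> (\<Inter>n. if x \<in> B n then B n else space M)"
  proof (intro equalityI subsetI)
    fix y assume y: "y \<in> space M \<inter> (\<Inter>n. if x \<in> B n then B n else space M)"
    then have "y \<in> B n" if "x \<in> B n" for n
      using that by (auto dest!: spec[of _ n])
    then show "y \<in> {x}"
      using separating[OF assms, of y] y by blast
  qed (use assms in auto)
  also have "\<dots> \<in> sets M"
    using B_sets by (intro sets.Int sets.top sets.countable_INT) auto
  finally show ?thesis .
qed

text \<open>
  Halving an atom repeatedly by the separating sets keeps its value, and in the limit only
  a point is left.
\<close>

lemma NA_iff: "\<mu> \<in> NA M \<longleftrightarrow> \<mu> \<in> signed_measures M \<and> (\<forall>x\<in>space M. \<mu> {x} = 0)"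
proof safe
  assume \<mu>: "\<mu> \<in> NA M"
  then show sm: "\<mu> \<in> signed_measures M"
    by (simp add: NA_def)
  fix x assume x: "x \<in> space M"
  show "\<mu> {x} = 0"
  proof (rule ccontr)
    assume "\<mu> {x} \<noteq> 0"
    then have "atom_of M \<mu> {x}"
      using x singleton_sets gamesD(1)[OF signed_measures_games[OF sm]]
      by (auto simp: atom_of_def subset_singleton_iff)
    then show False
      using \<mu> by (auto simp: NA_def)
  qed
next
  assume sm: "\<mu> \<in> signed_measures M" and point: "\<forall>x\<in>space M. \<mu> {x} = 0"
  have "\<not> atom_of M \<mu> A" for A
  proof
    assume A: "atom_of M \<mu> A"
    then have AM: "A \<in> sets M" and A0: "\<mu> A \<noteq> 0"
      and sub: "\<And>C. C \<in> sets M \<Longrightarrow> C \<subseteq> A \<Longrightarrow> \<mu> C = 0 \<or> \<mu> C = \<mu> A"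
      by (auto simp: atom_of_def)
    \<comment> \<open>If the inner half does not carry the full value, the atom property makes its
      value 0, and the outer half carries everything.\<close>
    define F where "F = rec_nat A (\<lambda>n C. if \<mu> (C \<inter> B n) = \<mu> A then C \<inter> B n else C - B n)"
    have F_simps: "F 0 = A" "F (Suc n) = (if \<mu> (F n \<inter> B n) = \<mu> A then F n \<inter> B n else F n - B n)" for n
      by (simp_all add: F_def)
    have F: "F n \<in> sets M \<and> F n \<subseteq> A \<and> \<mu> (F n) = \<mu> A" for n
    proof (induction n)
      case (Suc n)
      have "\<mu> ((F n \<inter> B n) \<union> (F n - B n)) = \<mu> (F n \<inter> B n) + \<mu> (F n - B n)"
        using Suc B_sets by (intro finitely_additiveD[OF signed_measures_additive[OF sm]]) auto
      moreover have "\<mu> (F n \<inter> B n) = 0 \<or> \<mu> (F n \<inter> B n) = \<mu> A"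
        using Suc B_sets by (intro sub) auto
      ultimately show ?case
        using Suc B_sets by (auto simp: F_simps Int_Diff_Un)
    qed (simp add: F_simps AM)
    have dec: "decseq F"
      by (rule decseq_SucI) (auto simp: F_simps)
    have "(\<lambda>n. \<mu> (F n)) \<longlonglongrightarrow> \<mu> (\<Inter>n. F n)"
      using F dec by (intro signed_measures_decseq[OF sm]) auto
    then have lim: "\<mu> (\<Inter>n. F n) = \<mu> A"
      using F by (simp add: LIMSEQ_const_iff)
    have "(\<Inter>n. F n) \<noteq> {}"
      using lim A0 gamesD(1)[OF signed_measures_games[OF sm]] by auto
    then obtain x where x: "x \<in> (\<Inter>n. F n)"
      by blast
    have "y = x" if y: "y \<in> (\<Inter>n. F n)" for y
    proof (rule ccontr)
      assume "y \<noteq> x"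
      moreover have "x \<in> space M" "y \<in> space M"
        using x y F[of 0] sets.sets_into_space by blast+
      ultimately obtain n where "y \<in> B n" "x \<notin> B n"
        using separating by blast
      moreover have "x \<in> F (Suc n)" "y \<in> F (Suc n)"
        using x y by blast+
      ultimately show False
        by (auto simp: F_simps split: if_splits)
    qed
    then have "(\<Inter>n. F n) = {x}"
      using x by blast
    moreover have "x \<in> space M"
      using x F[of 0] sets.sets_into_space by blast
    ultimately show False
      using lim A0 point by simp
  qed
  then show "\<mu> \<in> NA M"
    using sm by (simp add: NA_def)
qed

lemma NA_signed: "\<mu> \<in> NA M \<Longrightarrow> \<mu> \<in> signed_measures M"
  by (simp add: NA_def)

text \<open>Immediate from values at points, whereas atoms of a sum bear no simple relation to atoms
  of the summands.\<close>

lemma NA_add: "\<mu> \<in> NA M \<Longrightarrow> \<nu> \<in> NA M \<Longrightarrow> (\<lambda>E. \<mu> E + \<nu> E) \<in> NA M"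
  by (simp add: NA_iff signed_measures_add)

lemma NA_cmult: "\<mu> \<in> NA M \<Longrightarrow> (\<lambda>E. c * \<mu> E) \<in> NA M"
  by (simp add: NA_iff signed_measures_cmult)

lemma NA_uminus: "\<mu> \<in> NA M \<Longrightarrow> (\<lambda>E. - \<mu> E) \<in> NA M"
  using NA_cmult[of \<mu> "-1"] by simp

lemma NA_pos_signed: "\<mu> \<in> NA_pos M \<Longrightarrow> \<mu> \<in> signed_measures M"
  by (simp add: NA_pos_def NA_def)

lemma NA_pos_zero: "(\<lambda>E. 0) \<in> NA_pos M"
  by (simp add: NA_pos_def NA_iff signed_measures_def games_def)

lemma NA_pos_add: "\<mu> \<in> NA_pos M \<Longrightarrow> \<nu> \<in> NA_pos M \<Longrightarrow> (\<lambda>E. \<mu> E + \<nu> E) \<in> NA_pos M"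
  by (simp add: NA_pos_def NA_add)

lemma NA_pos_cmult: "\<mu> \<in> NA_pos M \<Longrightarrow> 0 \<le> c \<Longrightarrow> (\<lambda>E. c * \<mu> E) \<in> NA_pos M"
  by (simp add: NA_pos_def NA_cmult)

lemma NA_pos_mono:
  "\<mu> \<in> NA_pos M \<Longrightarrow> A \<in> sets M \<Longrightarrow> C \<in> sets M \<Longrightarrow> A \<subseteq> C \<Longrightarrow> \<mu> A \<le> \<mu> C"
  by (rule signed_measures_mono) (auto simp: NA_pos_def NA_def)

lemma NA_of_dominated:
  assumes f: "f \<in> games M" "finitely_additive M f"
    and \<mu>: "\<mu> \<in> NA_pos M" and le: "\<And>E. E \<in> sets M \<Longrightarrow> \<bar>f E\<bar> \<le> \<mu> E"
  shows "f \<in> NA M"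
  unfolding NA_iff
proof safe
  show "f \<in> signed_measures M"
    by (rule signed_measure_of_dominated[OF f NA_pos_signed[OF \<mu>] le])
  show "f {x} = 0" if "x \<in> space M" for x
    using le[OF singleton_sets[OF that]] that \<mu> by (simp add: NA_pos_def NA_iff)
qed

text \<open>Places \<open>NA M\<close> inside \<open>AC_inf M\<close>. The bound is the total
  variation: with \<open>P\<close> the positive variation, the negative part is
  \<open>P - \<mu>\<close>, and their sum is \<open>2 * P - \<mu>\<close>.\<close>

lemma NA_abs_le:
  assumes \<mu>: "\<mu> \<in> NA M"
  obtains \<eta> where "\<eta> \<in> NA_pos M" "\<And>E. E \<in> sets M \<Longrightarrow> \<bar>\<mu> E\<bar> \<le> \<eta> E"
proof
  let ?P = "positive_variation M \<mu>"
  have sm: "\<mu> \<in> signed_measures M"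
    using \<mu> by (simp add: NA_iff)
  have "?P {x} = 0" if x: "x \<in> space M" for x
  proof (rule antisym)
    show "?P {x} \<le> 0"
    proof (rule positive_variation_least[OF sm singleton_sets[OF x]])
      fix C assume "C \<subseteq> {x}"
      then have "C = {} \<or> C = {x}"
        by blast
      then show "\<mu> C \<le> 0"
        using \<mu> x gamesD(1)[OF signed_measures_games[OF sm]] by (auto simp: NA_iff)
    qed
  qed (rule positive_variation_nonneg[OF sm singleton_sets[OF x]])
  then have P: "?P \<in> NA M"
    by (simp add: NA_iff positive_variation_signed_measures[OF sm])
  have le: "\<mu> E \<le> ?P E" "0 \<le> ?P E" if "E \<in> sets M" for E
    using that positive_variation_upper[OF sm that that] positive_variation_nonneg[OF sm that] by auto
  show "\<bar>\<mu> E\<bar> \<le> 2 * ?P E + - \<mu> E" if "E \<in> sets M" for E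
    using le[OF that] by auto
  then show "(\<lambda>E. 2 * ?P E + - \<mu> E) \<in> NA_pos M"
    using NA_add[OF NA_cmult[OF P, of 2] NA_uminus[OF \<mu>]] by (force simp: NA_pos_def)
qed

section \<open>Existence of partitions of small mesh\<close>

lemma mesh_less_iff:
  assumes "finite D"
  shows "mesh \<kappa> D < \<delta> \<longleftrightarrow> 0 < \<delta> \<and> (\<forall>I\<in>D. \<kappa> I < \<delta>)"
  using assms by (simp add: mesh_def)

text \<open>Around each point the finite intersections of separating sets shrink to that point,
  where \<open>\<kappa>\<close> is 0, so some of them have small value. There are only countably
  many such intersections.\<close>

lemma small_cover:
  assumes \<kappa>: "\<kappa> \<in> NA_pos M" and "0 < \<delta>"
  obtains G :: "nat \<Rightarrow> 'a set"
    where "\<And>n. G n \<in> sets M" "\<And>n. \<kappa> (G n) < \<delta>" "(\<Union>n. G n) = space M"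
proof -
  have sm: "\<kappa> \<in> signed_measures M" and point: "\<And>x. x \<in> space M \<Longrightarrow> \<kappa> {x} = 0"
    using \<kappa> by (auto simp: NA_pos_def NA_iff)
  define V where "V S = space M \<inter> (\<Inter>i\<in>S. B i)" for S
  have V: "V S \<in> sets M" if "finite S" for S
    using that
  proof (induction S rule: finite_induct)
    case (insert i S)
    have "V (insert i S) = B i \<inter> V S"
      by (auto simp: V_def)
    then show ?case
      using insert B_sets by simp
  qed (simp add: V_def)
  \<comment> \<open>Indexing by finite sets of numbers makes the family countable; the empty set
    keeps it nonempty and has value 0, below \<open>\<delta>\<close>.\<close>
  define \<G> where "\<G> = insert {} (V ` {S. finite S \<and> \<kappa> (V S) < \<delta>})"
  have \<G>: "countable \<G>" "\<G> \<noteq> {}"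
    unfolding \<G>_def using countable_Collect_finite[where 'a = nat]
    by (auto intro!: countable_image intro: countable_subset[rotated])
  have mem: "C \<in> sets M \<and> \<kappa> C < \<delta> \<and> C \<subseteq> space M" if "C \<in> \<G>" for C
    using that V \<open>0 < \<delta>\<close> gamesD(1)[OF signed_measures_games[OF sm]]
    by (auto simp: \<G>_def V_def)
  have cover: "x \<in> \<Union>\<G>" if x: "x \<in> space M" for x
  proof -
    define F where "F n = V {i. i < n \<and> x \<in> B i}" for n
    have "y = x" if "\<And>n. y \<in> F n" for y
    proof (rule ccontr)
      assume "y \<noteq> x"
      moreover have "y \<in> space M"
        using that[of 0] by (simp add: F_def V_def)
      ultimately obtain n where "x \<in> B n" "y \<notin> B n"
        using separating x by metis
      then show False
        using that[of "Suc n"] by (auto simp: F_def V_def)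
    qed
    then have "(\<Inter>n. F n) = {x}"
      using x by (auto simp: F_def V_def)
    moreover have "decseq F" "range F \<subseteq> sets M"
      unfolding decseq_def F_def using V by (auto simp: V_def)
    ultimately have "(\<lambda>n. \<kappa> (F n)) \<longlonglongrightarrow> 0"
      using signed_measures_decseq[OF sm, of F] point[OF x] by simp
    then obtain n where "\<kappa> (F n) < \<delta>"
      using order_tendstoD(2)[OF _ \<open>0 < \<delta>\<close>] by (metis (no_types, lifting) eventually_sequentially order_refl)
    then have "F n \<in> \<G>"
      by (auto simp: \<G>_def F_def)
    moreover have "x \<in> F n"
      using x by (simp add: F_def V_def)
    ultimately show ?thesis
      by blast
  qed
  show thesis
  proof
    show "from_nat_into \<G> n \<in> sets M" "\<kappa> (from_nat_into \<G> n) < \<delta>" for n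
      using mem[OF from_nat_into[OF \<G>(2)]] by auto
    show "(\<Union>n. from_nat_into \<G> n) = space M"
      using cover mem by (auto simp: range_from_nat_into[OF \<G>(2,1)])
  qed
qed

text \<open>The countable cover is made disjoint and truncated: what is left of \<open>E\<close>
  after \<open>N\<close> pieces decreases to the empty set, so for large \<open>N\<close> it is
  small enough to form one last cell.\<close>

lemma fine_partition:
  assumes \<kappa>: "\<kappa> \<in> NA_pos M" and "0 < \<delta>" and E: "E \<in> sets M"
  obtains D where "D \<in> partitions M E" "mesh \<kappa> D < \<delta>"
proof -
  have sm: "\<kappa> \<in> signed_measures M"
    using \<kappa> by (rule NA_pos_signed)
  obtain G :: "nat \<Rightarrow> 'a set"
    where G: "\<And>n. G n \<in> sets M" "\<And>n. \<kappa> (G n) < \<delta>" "(\<Union>n. G n) = space M"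
    using small_cover[OF assms(1,2)] by metis
  let ?C = "disjointed G"
  have C: "?C n \<in> sets M" "?C n \<subseteq> G n" for n
    using sets.range_disjointed_sets[of G M] G(1) disjointed_subset[of G n] by auto
  define R where "R n = E - (\<Union>i<n. ?C i)" for n
  have R: "R n \<in> sets M" for n
    using C E by (auto simp: R_def)
  have "(\<Inter>n. R n) = {}"
  proof -
    have "x \<notin> (\<Inter>n. R n)" if "x \<in> E" for x
    proof -
      have "x \<in> (\<Union>n. ?C n)"
        using that sets.sets_into_space[OF E] G(3) by (auto simp: UN_disjointed_eq)
      then obtain n where "x \<in> ?C n"
        by blast
      then have "x \<notin> R (Suc n)"
        by (auto simp: R_def)
      then show ?thesis
        by blast
    qed
    then show ?thesis
      by (auto simp: R_def)
  qed
  moreover have "decseq R"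
    unfolding decseq_def R_def by fastforce
  ultimately have "(\<lambda>n. \<kappa> (R n)) \<longlonglongrightarrow> 0"
    using signed_measures_decseq[OF sm, of R] R gamesD(1)[OF signed_measures_games[OF sm]] by auto
  then obtain N where N: "\<kappa> (R N) < \<delta>"
    using order_tendstoD(2)[OF _ \<open>0 < \<delta>\<close>] by (metis (no_types, lifting) eventually_sequentially order_refl)
  \<comment> \<open>Pieces that miss \<open>E\<close> are empty, and \<open>partition_on\<close>
    forbids empty cells.\<close>
  define D where "D = insert (R N) ((\<lambda>i. E \<inter> ?C i) ` {..<N}) - {{}}"
  have small: "\<kappa> (E \<inter> ?C i) < \<delta>" for i
  proof (rule le_less_trans)
    show "\<kappa> (E \<inter> ?C i) \<le> \<kappa> (G i)"
      using C[of i] E G(1) by (intro NA_pos_mono[OF \<kappa>]) auto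
  qed (rule G(2))
  have "(E \<inter> ?C i) \<inter> (E \<inter> ?C j) = {}" if "i \<noteq> j" for i j
    using disjoint_family_disjointed[of G] that by (auto simp: disjoint_family_on_def)
  then have "disjoint ((\<lambda>i. E \<inter> ?C i) ` {..<N})"
    unfolding disjoint_def by (smt (verit) imageE)
  moreover have "disjnt (R N) (E \<inter> ?C i)" "disjnt (E \<inter> ?C i) (R N)" if "i < N" for i
    using that by (auto simp: R_def disjnt_def)
  ultimately have "disjoint (insert (R N) ((\<lambda>i. E \<inter> ?C i) ` {..<N}))"
    by (auto simp: pairwise_insert)
  then have "disjoint D"
    unfolding D_def by (rule pairwise_subset) blast
  moreover have "\<Union>(\<A> - {{}}) = \<Union>\<A>" for \<A> :: "'a set set"
    by blast
  then have "\<Union>D = R N \<union> (\<Union>i<N. E \<inter> ?C i)"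
    unfolding D_def by simp
  then have "\<Union>D = E"
    unfolding R_def by blast
  ultimately have "partition_on E D"
    by (simp add: partition_on_def) (simp add: D_def)
  moreover have "finite D" "D \<subseteq> sets M"
    using C E R by (auto simp: D_def)
  ultimately have "D \<in> partitions M E"
    by (simp add: partitions_def)
  moreover have "mesh \<kappa> D < \<delta>"
    unfolding mesh_less_iff[OF \<open>finite D\<close>] using N small \<open>0 < \<delta>\<close> by (auto simp: D_def)
  ultimately show thesis
    by (rule that)
qed

end

section \<open>The Burkill-Cesari limit\<close>

text \<open>As a limit along a filter, the integral inherits linearity, uniqueness and bounds from
  \<open>tendsto\<close>, and products of filters become available for additivity.\<close>

definition fine_partitions :: "'a measure \<Rightarrow> 'a game \<Rightarrow> 'a set \<Rightarrow> 'a set set filter" where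
  "fine_partitions M \<kappa> E = (INF \<delta>\<in>{0<..}. principal {D \<in> partitions M E. mesh \<kappa> D < \<delta>})"

lemma eventually_fine_partitions:
  "eventually P (fine_partitions M \<kappa> E) \<longleftrightarrow> (\<exists>\<delta>>0. \<forall>D\<in>partitions M E. mesh \<kappa> D < \<delta> \<longrightarrow> P D)"
  unfolding fine_partitions_def
proof (subst eventually_INF_base)
  fix \<delta> \<delta>' :: real assume "\<delta> \<in> {0<..}" "\<delta>' \<in> {0<..}"
  then show "\<exists>x\<in>{0<..}. principal {D \<in> partitions M E. mesh \<kappa> D < x}
      \<le> inf (principal {D \<in> partitions M E. mesh \<kappa> D < \<delta>}) (principal {D \<in> partitions M E. mesh \<kappa> D < \<delta>'})"
    by (intro bexI[of _ "min \<delta> \<delta>'"]) auto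
qed (auto simp: eventually_principal)

lemma has_BC_limit_iff_tendsto:
  "has_BC_limit M \<kappa> \<nu> E l \<longleftrightarrow> ((\<lambda>D. \<Sum>I\<in>D. \<nu> I) \<longlongrightarrow> l) (fine_partitions M \<kappa> E)"
  by (simp add: has_BC_limit_def tendsto_iff eventually_fine_partitions dist_real_def)

lemma partitionsD:
  assumes "D \<in> partitions M E"
  shows "finite D" "\<And>I. I \<in> D \<Longrightarrow> I \<in> sets M" "\<And>I. I \<in> D \<Longrightarrow> I \<subseteq> E" "disjoint D" "\<Union>D = E" "{} \<notin> D"
  using assms by (auto simp: partitions_def partition_on_def)

lemma has_BC_limit_add:
  "has_BC_limit M \<kappa> \<nu> E l \<Longrightarrow> has_BC_limit M \<kappa> \<eta> E l' \<Longrightarrow> has_BC_limit M \<kappa> (\<lambda>E. \<nu> E + \<eta> E) E (l + l')"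
  by (simp add: has_BC_limit_iff_tendsto sum.distrib tendsto_add)

lemma has_BC_limit_cmult:
  "has_BC_limit M \<kappa> \<nu> E l \<Longrightarrow> has_BC_limit M \<kappa> (\<lambda>E. c * \<nu> E) E (c * l)"
  by (simp add: has_BC_limit_iff_tendsto sum_distrib_left[symmetric] tendsto_mult_left)

lemma has_BC_limit_measure:
  assumes "\<mu> \<in> signed_measures M"
  shows "has_BC_limit M \<kappa> \<mu> E (\<mu> E)"
  using finitely_additive_partition[OF signed_measures_additive[OF assms] gamesD(1)[OF signed_measures_games[OF assms]]]
  by (auto simp: has_BC_limit_def intro: exI[of _ 1])

text \<open>A larger control has a larger mesh, so smallness for \<open>\<kappa>'\<close> implies
  smallness for \<open>\<kappa>\<close>. This is what allows passing to a common control.\<close>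

lemma has_BC_limit_mono_control:
  assumes "has_BC_limit M \<kappa> \<nu> E l" "\<And>I. I \<in> sets M \<Longrightarrow> \<kappa> I \<le> \<kappa>' I"
  shows "has_BC_limit M \<kappa>' \<nu> E l"
proof -
  have "mesh \<kappa> D \<le> mesh \<kappa>' D" if D: "D \<in> partitions M E" for D
  proof -
    have "\<kappa> I \<le> Max (insert 0 (\<kappa>' ` D))" if I: "I \<in> D" for I
    proof -
      have "\<kappa> I \<le> \<kappa>' I"
        using assms(2) partitionsD(2)[OF D I] by blast
      also have "\<dots> \<le> Max (insert 0 (\<kappa>' ` D))"
        using partitionsD(1)[OF D] I by (intro Max_ge) auto
      finally show ?thesis .
    qed
    moreover have "0 \<le> Max (insert 0 (\<kappa>' ` D))"
      using partitionsD(1)[OF D] by (intro Max_ge) auto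
    ultimately show ?thesis
      unfolding mesh_def using partitionsD(1)[OF D] by (intro Max.boundedI) auto
  qed
  then show ?thesis
    using assms(1) unfolding has_BC_limit_def by (meson le_less_trans)
qed

context countably_separated
begin

lemma fine_partitions_nontrivial:
  assumes "\<kappa> \<in> NA_pos M" "E \<in> sets M"
  shows "fine_partitions M \<kappa> E \<noteq> bot"
proof -
  have "\<exists>D\<in>partitions M E. mesh \<kappa> D < \<delta>" if "0 < \<delta>" for \<delta>
    using fine_partition[OF assms(1) that assms(2)] by blast
  then show ?thesis
    unfolding trivial_limit_def eventually_fine_partitions by simp
qed

lemma has_BC_limit_lower_bound:
  assumes "\<kappa> \<in> NA_pos M" "E \<in> sets M" "has_BC_limit M \<kappa> \<nu> E l"
    and "\<And>D. D \<in> partitions M E \<Longrightarrow> c \<le> (\<Sum>I\<in>D. \<nu> I)"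
  shows "c \<le> l"
proof (rule tendsto_lowerbound)
  show "((\<lambda>D. \<Sum>I\<in>D. \<nu> I) \<longlongrightarrow> l) (fine_partitions M \<kappa> E)"
    using assms(3) by (simp add: has_BC_limit_iff_tendsto)
  show "\<forall>\<^sub>F D in fine_partitions M \<kappa> E. c \<le> (\<Sum>I\<in>D. \<nu> I)"
    using assms(4) by (auto simp: eventually_fine_partitions intro: exI[of _ 1])
qed (rule fine_partitions_nontrivial[OF assms(1,2)])

text \<open>The sums of \<open>\<mu>\<close> are constant, so the limit for
  \<open>\<mu> - \<nu>\<close> is a limit of nonnegative sums. Being one-sided with a signed
  \<open>\<mu>\<close>, it serves both the Lipschitz bound and the comparison with
  majorants.\<close>

lemma has_BC_limit_le:
  assumes "\<kappa> \<in> NA_pos M" "E \<in> sets M" "has_BC_limit M \<kappa> \<nu> E l" "\<mu> \<in> signed_measures M"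
    and "\<And>I. I \<in> sets M \<Longrightarrow> \<nu> I \<le> \<mu> I"
  shows "l \<le> \<mu> E"
proof -
  have "has_BC_limit M \<kappa> (\<lambda>I. \<mu> I + (-1) * \<nu> I) E (\<mu> E + (-1) * l)"
    using assms by (intro has_BC_limit_add has_BC_limit_cmult has_BC_limit_measure)
  moreover have "0 \<le> (\<Sum>I\<in>D. \<mu> I + (-1) * \<nu> I)" if "D \<in> partitions M E" for D
    using assms(5)[OF partitionsD(2)[OF that]] by (intro sum_nonneg) simp
  ultimately have "0 \<le> \<mu> E + (-1) * l"
    using has_BC_limit_lower_bound[OF assms(1,2)] by blast
  then show ?thesis
    by simp
qed

text \<open>Both limits survive under the control \<open>\<kappa> + \<kappa>'\<close>, whose filter
  is proper. Hence the description in \<open>BC_integral\<close> is unambiguous.\<close>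

lemma has_BC_limit_unique:
  assumes "\<kappa> \<in> NA_pos M" "\<kappa>' \<in> NA_pos M" "E \<in> sets M"
    and "has_BC_limit M \<kappa> \<nu> E l" "has_BC_limit M \<kappa>' \<nu> E l'"
  shows "l = l'"
proof (rule tendsto_unique)
  let ?\<kappa> = "\<lambda>E. \<kappa> E + \<kappa>' E"
  have "has_BC_limit M ?\<kappa> \<nu> E l" "has_BC_limit M ?\<kappa> \<nu> E l'"
    using assms(1,2) by (auto intro: has_BC_limit_mono_control[OF assms(4)]
        has_BC_limit_mono_control[OF assms(5)] simp: NA_pos_def)
  then show "((\<lambda>D. \<Sum>I\<in>D. \<nu> I) \<longlongrightarrow> l) (fine_partitions M ?\<kappa> E)"
    "((\<lambda>D. \<Sum>I\<in>D. \<nu> I) \<longlongrightarrow> l') (fine_partitions M ?\<kappa> E)"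
    by (simp_all add: has_BC_limit_iff_tendsto)
  show "fine_partitions M ?\<kappa> E \<noteq> bot"
    using assms by (intro fine_partitions_nontrivial NA_pos_add)
qed

section \<open>The integral as a function on \<open>BC M\<close>: linearity and additivity\<close>

lemma BC_integral_eqI:
  assumes "\<kappa> \<in> NA_pos M" "\<And>E. E \<in> sets M \<Longrightarrow> has_BC_limit M \<kappa> \<nu> E (f E)" "E \<in> sets M"
  shows "BC_integral M \<nu> E = f E"
proof -
  have "(THE l. \<exists>\<kappa>\<in>NA_pos M. BC_integrable M \<kappa> \<nu> \<and> has_BC_limit M \<kappa> \<nu> E l) = f E"
    using assms by (intro the_equality) (auto simp: BC_integrable_def intro: has_BC_limit_unique)
  then show ?thesis
    using assms(3) by (simp add: BC_integral_def)
qed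

lemma BC_I:
  assumes "\<nu> \<in> games M" "\<kappa> \<in> NA_pos M" "\<And>E. E \<in> sets M \<Longrightarrow> has_BC_limit M \<kappa> \<nu> E (f E)"
  shows "\<nu> \<in> BC M"
  using assms by (auto simp: BC_def BC_integrable_def)

lemma BC_integral_eq:
  assumes "\<kappa> \<in> NA_pos M" "\<And>E. E \<in> sets M \<Longrightarrow> has_BC_limit M \<kappa> \<nu> E (f E)" "\<And>E. E \<notin> sets M \<Longrightarrow> f E = 0"
  shows "BC_integral M \<nu> = f"
proof
  show "BC_integral M \<nu> E = f E" for E
    using BC_integral_eqI[OF assms(1,2)] assms(3) by (cases "E \<in> sets M") (auto simp: BC_integral_def)
qed

lemma BC_E:
  assumes "\<nu> \<in> BC M"
  obtains \<kappa> where "\<kappa> \<in> NA_pos M" "\<And>E. E \<in> sets M \<Longrightarrow> has_BC_limit M \<kappa> \<nu> E (BC_integral M \<nu> E)"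
proof -
  obtain \<kappa> where \<kappa>: "\<kappa> \<in> NA_pos M" "\<forall>E\<in>sets M. \<exists>l. has_BC_limit M \<kappa> \<nu> E l"
    using assms by (auto simp: BC_def BC_integrable_def)
  then obtain f where "\<And>E. E \<in> sets M \<Longrightarrow> has_BC_limit M \<kappa> \<nu> E (f E)"
    by metis
  then show thesis
    using that[OF \<kappa>(1)] BC_integral_eqI[OF \<kappa>(1)] by metis
qed

lemma BC_E2:
  assumes "\<nu> \<in> BC M" "\<eta> \<in> BC M"
  obtains \<kappa> where "\<kappa> \<in> NA_pos M"
    "\<And>E. E \<in> sets M \<Longrightarrow> has_BC_limit M \<kappa> \<nu> E (BC_integral M \<nu> E)"
    "\<And>E. E \<in> sets M \<Longrightarrow> has_BC_limit M \<kappa> \<eta> E (BC_integral M \<eta> E)"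
proof -
  obtain \<kappa> where \<kappa>: "\<kappa> \<in> NA_pos M" "\<And>E. E \<in> sets M \<Longrightarrow> has_BC_limit M \<kappa> \<nu> E (BC_integral M \<nu> E)"
    using BC_E[OF assms(1)] by metis
  obtain \<kappa>' where \<kappa>': "\<kappa>' \<in> NA_pos M" "\<And>E. E \<in> sets M \<Longrightarrow> has_BC_limit M \<kappa>' \<eta> E (BC_integral M \<eta> E)"
    using BC_E[OF assms(2)] by metis
  have "\<kappa> I \<le> \<kappa> I + \<kappa>' I" "\<kappa>' I \<le> \<kappa> I + \<kappa>' I" if "I \<in> sets M" for I
    using \<kappa>(1) \<kappa>'(1) that by (auto simp: NA_pos_def)
  then show thesis
    by (intro that[OF NA_pos_add[OF \<kappa>(1) \<kappa>'(1)]] has_BC_limit_mono_control[OF \<kappa>(2)]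
        has_BC_limit_mono_control[OF \<kappa>'(2)])
qed

lemma BC_add:
  assumes "\<nu> \<in> BC M" "\<eta> \<in> BC M"
  shows "(\<lambda>E. \<nu> E + \<eta> E) \<in> BC M"
    and "BC_integral M (\<lambda>E. \<nu> E + \<eta> E) = (\<lambda>E. BC_integral M \<nu> E + BC_integral M \<eta> E)"
proof -
  obtain \<kappa> where \<kappa>: "\<kappa> \<in> NA_pos M"
    "\<And>E. E \<in> sets M \<Longrightarrow> has_BC_limit M \<kappa> \<nu> E (BC_integral M \<nu> E)"
    "\<And>E. E \<in> sets M \<Longrightarrow> has_BC_limit M \<kappa> \<eta> E (BC_integral M \<eta> E)"
    using BC_E2[OF assms] by metis
  note lim = has_BC_limit_add[OF \<kappa>(2,3)]
  show "(\<lambda>E. \<nu> E + \<eta> E) \<in> BC M"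
    using assms by (intro BC_I[OF _ \<kappa>(1) lim]) (auto simp: BC_def games_def)
  show "BC_integral M (\<lambda>E. \<nu> E + \<eta> E) = (\<lambda>E. BC_integral M \<nu> E + BC_integral M \<eta> E)"
    by (intro BC_integral_eq[OF \<kappa>(1) lim]) (auto simp: BC_integral_def)
qed

lemma BC_cmult:
  assumes "\<nu> \<in> BC M"
  shows "(\<lambda>E. c * \<nu> E) \<in> BC M"
    and "BC_integral M (\<lambda>E. c * \<nu> E) = (\<lambda>E. c * BC_integral M \<nu> E)"
proof -
  obtain \<kappa> where \<kappa>: "\<kappa> \<in> NA_pos M"
    "\<And>E. E \<in> sets M \<Longrightarrow> has_BC_limit M \<kappa> \<nu> E (BC_integral M \<nu> E)"
    using BC_E[OF assms] by metis
  note lim = has_BC_limit_cmult[OF \<kappa>(2)]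
  show "(\<lambda>E. c * \<nu> E) \<in> BC M"
    using assms by (intro BC_I[OF _ \<kappa>(1) lim]) (auto simp: BC_def games_def)
  show "BC_integral M (\<lambda>E. c * \<nu> E) = (\<lambda>E. c * BC_integral M \<nu> E)"
    by (intro BC_integral_eq[OF \<kappa>(1) lim]) (auto simp: BC_integral_def)
qed

text \<open>The approximating sums are constant, so even the zero measure serves as control.\<close>

lemma BC_measure:
  assumes "\<mu> \<in> signed_measures M"
  shows "\<mu> \<in> BC M" and "BC_integral M \<mu> = \<mu>"
  using BC_I[OF signed_measures_games[OF assms] NA_pos_zero has_BC_limit_measure[OF assms]]
    BC_integral_eq[OF NA_pos_zero has_BC_limit_measure[OF assms] gamesD(2)[OF signed_measures_games[OF assms]]]
  by auto

text \<open>A fine partition of \<open>A \<union> C\<close> need not respect the two parts, but a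
  limit along all fine partitions is also the limit along those glued from partitions of
  \<open>A\<close> and of \<open>C\<close>, and on these the sums split.\<close>

lemma BC_integral_additive:
  assumes "\<nu> \<in> BC M"
  shows "finitely_additive M (BC_integral M \<nu>)"
  unfolding finitely_additive_def
proof (intro ballI impI)
  fix A C assume AC: "A \<in> sets M" "C \<in> sets M" "A \<inter> C = {}"
  obtain \<kappa> where \<kappa>: "\<kappa> \<in> NA_pos M"
    "\<And>E. E \<in> sets M \<Longrightarrow> has_BC_limit M \<kappa> \<nu> E (BC_integral M \<nu> E)"
    using BC_E[OF assms] by metis
  let ?F = "fine_partitions M \<kappa>" and ?S = "\<lambda>D. \<Sum>I\<in>D. \<nu> I"
  have tendsto: "(?S \<longlongrightarrow> BC_integral M \<nu> E) (?F E)" if "E \<in> sets M" for E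
    using \<kappa>(2)[OF that] by (simp add: has_BC_limit_iff_tendsto)
  have union: "D \<union> D' \<in> partitions M (A \<union> C) \<and> ?S (D \<union> D') = ?S D + ?S D'"
    if D: "D \<in> partitions M A" "D' \<in> partitions M C" for D D'
  proof -
    \<comment> \<open>A common cell would be counted once in the union but twice in the two sums; it
      is excluded because cells are nonempty.\<close>
    have "D \<inter> D' = {}"
    proof (rule equals0I)
      fix I assume "I \<in> D \<inter> D'"
      then have "I \<subseteq> A \<inter> C" "I \<noteq> {}"
        using partitionsD(3,6)[OF D(1)] partitionsD(3)[OF D(2)] by auto
      then show False
        using AC(3) by blast
    qed
    then have "?S (D \<union> D') = ?S D + ?S D'"
      using partitionsD(1)[OF D(1)] partitionsD(1)[OF D(2)] by (simp add: sum.union_disjoint)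
    moreover have "disjoint (D \<union> D')"
      using partitionsD(4,5)[OF D(1)] partitionsD(4,5)[OF D(2)] AC(3)
      by (intro disjoint_union) simp_all
    ultimately show ?thesis
      using D by (auto simp: partitions_def partition_on_def)
  qed
  \<comment> \<open>Gluing keeps the mesh below any \<open>\<delta>\<close> that bounds both
    meshes.\<close>
  have "filterlim (\<lambda>(D, D'). D \<union> D') (?F (A \<union> C)) (?F A \<times>\<^sub>F ?F C)"
    unfolding filterlim_iff
  proof (intro allI impI)
    fix P assume "eventually P (?F (A \<union> C))"
    then obtain \<delta> where \<delta>: "0 < \<delta>" "\<And>D. D \<in> partitions M (A \<union> C) \<Longrightarrow> mesh \<kappa> D < \<delta> \<Longrightarrow> P D"
      by (auto simp: eventually_fine_partitions)
    let ?Q = "\<lambda>E D. D \<in> partitions M E \<and> mesh \<kappa> D < \<delta>"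
    have "eventually (?Q E) (?F E)" for E
      using \<delta>(1) by (auto simp: eventually_fine_partitions)
    moreover have "P (D \<union> D')" if D: "?Q A D" "?Q C D'" for D D'
    proof (rule \<delta>(2))
      show "D \<union> D' \<in> partitions M (A \<union> C)"
        using D union by blast
      then show "mesh \<kappa> (D \<union> D') < \<delta>"
        using D partitionsD(1) by (subst mesh_less_iff) (auto simp: mesh_less_iff)
    qed
    ultimately show "eventually (\<lambda>p. P (case p of (D, D') \<Rightarrow> D \<union> D')) (?F A \<times>\<^sub>F ?F C)"
      unfolding eventually_prod_filter by (intro exI[of _ "?Q A"] exI[of _ "?Q C"]) auto
  qed
  from filterlim_compose[OF tendsto[OF sets.Un[OF AC(1,2)]] this]
  have "((\<lambda>(D, D'). ?S (D \<union> D')) \<longlongrightarrow> BC_integral M \<nu> (A \<union> C)) (?F A \<times>\<^sub>F ?F C)"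
    unfolding case_prod_unfold .
  moreover have "((\<lambda>(D, D'). ?S D + ?S D') \<longlongrightarrow> BC_integral M \<nu> A + BC_integral M \<nu> C) (?F A \<times>\<^sub>F ?F C)"
    unfolding case_prod_unfold
    using filterlim_compose[OF tendsto[OF AC(1)] filterlim_fst] filterlim_compose[OF tendsto[OF AC(2)] filterlim_snd]
    by (rule tendsto_add)
  then have "((\<lambda>(D, D'). ?S (D \<union> D')) \<longlongrightarrow> BC_integral M \<nu> A + BC_integral M \<nu> C) (?F A \<times>\<^sub>F ?F C)"
  proof (rule Lim_transform_eventually)
    have "eventually (\<lambda>D. D \<in> partitions M E) (?F E)" for E
      by (auto simp: eventually_fine_partitions intro: exI[of _ 1])
    then show "eventually (\<lambda>p. (case p of (D, D') \<Rightarrow> ?S D + ?S D') = (case p of (D, D') \<Rightarrow> ?S (D \<union> D')))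
        (?F A \<times>\<^sub>F ?F C)"
      unfolding eventually_prod_filter using union
      by (intro exI[of _ "\<lambda>D. D \<in> partitions M A"] exI[of _ "\<lambda>D. D \<in> partitions M C"]) auto
  qed
  moreover have "?F A \<times>\<^sub>F ?F C \<noteq> bot"
    using fine_partitions_nontrivial[OF \<kappa>(1)] AC by (simp add: prod_filter_eq_bot)
  ultimately show "BC_integral M \<nu> (A \<union> C) = BC_integral M \<nu> A + BC_integral M \<nu> C"
    using tendsto_unique by blast
qed

end

section \<open>Lipschitz games\<close>

context countably_separated
begin

text \<open>The two order relations amount to one Lipschitz estimate on increments. Along a chain
  the increments of \<open>\<mu>\<close> telescope to \<open>\<mu> (space M)\<close>, which is how
  the estimate yields bounded variation.\<close>

lemma AC_inf_iff:
  "\<nu> \<in> AC_inf M \<longleftrightarrow> \<nu> \<in> games M \<and>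
    (\<exists>\<mu>\<in>NA_pos M. \<forall>A\<in>sets M. \<forall>C\<in>sets M. A \<subseteq> C \<longrightarrow> \<bar>\<nu> C - \<nu> A\<bar> \<le> \<mu> C - \<mu> A)"
  (is "_ \<longleftrightarrow> _ \<and> (\<exists>\<mu>\<in>_. ?lip \<mu>)")
proof -
  have lip: "?lip \<mu> \<longleftrightarrow> game_le M (\<lambda>E. - \<mu> E) \<nu> \<and> game_le M \<nu> \<mu>" for \<mu>
  proof -
    have "\<bar>\<nu> C - \<nu> A\<bar> \<le> \<mu> C - \<mu> A \<longleftrightarrow> \<nu> A - - \<mu> A \<le> \<nu> C - - \<mu> C \<and> \<mu> A - \<nu> A \<le> \<mu> C - \<nu> C" for A C
      by linarith
    then show ?thesis
      unfolding game_le_def monotone_game_def by blast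
  qed
  have BV: "\<nu> \<in> BV M" if "\<nu> \<in> games M" "\<mu> \<in> NA_pos M" "?lip \<mu>" for \<mu>
    unfolding BV_def
  proof (intro CollectI conjI bdd_aboveI)
    show "\<nu> \<in> games M"
      by fact
    fix v assume "v \<in> {(\<Sum>i<m. \<bar>\<nu> (S (Suc i)) - \<nu> (S i)\<bar>) | (S :: nat \<Rightarrow> 'a set) m.
       S 0 = {} \<and> S m = space M \<and> (\<forall>i\<le>m. S i \<in> sets M) \<and> (\<forall>i<m. S i \<subseteq> S (Suc i))}"
    then obtain S :: "nat \<Rightarrow> 'a set" and m
      where v: "v = (\<Sum>i<m. \<bar>\<nu> (S (Suc i)) - \<nu> (S i)\<bar>)"
        and S: "S 0 = {}" "S m = space M" "\<forall>i\<le>m. S i \<in> sets M" "\<forall>i<m. S i \<subseteq> S (Suc i)"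
      by blast
    have "v \<le> (\<Sum>i<m. \<mu> (S (Suc i)) - \<mu> (S i))"
      unfolding v using S(3,4) that(3) by (intro sum_mono) (simp add: Suc_leI)
    also have "\<dots> = \<mu> (space M)"
      using S(1,2) gamesD(1)[OF signed_measures_games[OF NA_pos_signed[OF that(2)]]]
      by (simp add: sum_lessThan_telescope[where f = "\<lambda>i. \<mu> (S i)"])
    finally show "v \<le> \<mu> (space M)" .
  qed
  have "\<nu> \<in> AC_inf M \<longleftrightarrow> \<nu> \<in> BV M \<and> (\<exists>\<mu>\<in>NA_pos M. ?lip \<mu>)"
    unfolding AC_inf_def mem_Collect_eq lip ..
  moreover have "\<nu> \<in> games M" if "\<nu> \<in> BV M"
    using that by (simp add: BV_def)
  ultimately have "\<nu> \<in> AC_inf M \<longleftrightarrow> \<nu> \<in> games M \<and> \<nu> \<in> BV M \<and> (\<exists>\<mu>\<in>NA_pos M. ?lip \<mu>)"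
    by auto
  moreover have "\<nu> \<in> BV M" if "\<nu> \<in> games M" "\<exists>\<mu>\<in>NA_pos M. ?lip \<mu>"
    using that(2) BV[OF that(1)] by (elim bexE)
  ultimately show ?thesis
    by argo
qed

lemma AC_infE:
  assumes "\<nu> \<in> AC_inf M"
  obtains \<mu> where "\<mu> \<in> NA_pos M"
    "\<And>A C. A \<in> sets M \<Longrightarrow> C \<in> sets M \<Longrightarrow> A \<subseteq> C \<Longrightarrow> \<bar>\<nu> C - \<nu> A\<bar> \<le> \<mu> C - \<mu> A"
    "\<And>E. E \<in> sets M \<Longrightarrow> \<bar>\<nu> E\<bar> \<le> \<mu> E"
proof -
  obtain \<mu> where \<mu>: "\<mu> \<in> NA_pos M"
    and lip: "\<And>A C. A \<in> sets M \<Longrightarrow> C \<in> sets M \<Longrightarrow> A \<subseteq> C \<Longrightarrow> \<bar>\<nu> C - \<nu> A\<bar> \<le> \<mu> C - \<mu> A"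
    using assms unfolding AC_inf_iff by metis
  have "\<bar>\<nu> E\<bar> \<le> \<mu> E" if "E \<in> sets M" for E
    using lip[of "{}" E] that gamesD(1)[OF signed_measures_games[OF NA_pos_signed[OF \<mu>]]] assms
    by (auto simp: AC_inf_iff gamesD(1))
  then show thesis
    using that[OF \<mu> lip] by blast
qed

lemma AC_inf_games: "\<nu> \<in> AC_inf M \<Longrightarrow> \<nu> \<in> games M"
  by (simp add: AC_inf_iff)

lemma AC_inf_add:
  assumes "\<nu> \<in> AC_inf M" "\<eta> \<in> AC_inf M"
  shows "(\<lambda>E. \<nu> E + \<eta> E) \<in> AC_inf M"
proof -
  obtain \<mu> where \<mu>: "\<mu> \<in> NA_pos M"
    "\<And>A C. A \<in> sets M \<Longrightarrow> C \<in> sets M \<Longrightarrow> A \<subseteq> C \<Longrightarrow> \<bar>\<nu> C - \<nu> A\<bar> \<le> \<mu> C - \<mu> A"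
    using AC_infE[OF assms(1)] by metis
  obtain \<mu>' where \<mu>': "\<mu>' \<in> NA_pos M"
    "\<And>A C. A \<in> sets M \<Longrightarrow> C \<in> sets M \<Longrightarrow> A \<subseteq> C \<Longrightarrow> \<bar>\<eta> C - \<eta> A\<bar> \<le> \<mu>' C - \<mu>' A"
    using AC_infE[OF assms(2)] by metis
  have "\<bar>(\<nu> C + \<eta> C) - (\<nu> A + \<eta> A)\<bar> \<le> (\<mu> C + \<mu>' C) - (\<mu> A + \<mu>' A)"
    if "A \<in> sets M" "C \<in> sets M" "A \<subseteq> C" for A C
    using \<mu>(2)[OF that] \<mu>'(2)[OF that] by linarith
  moreover have "(\<lambda>E. \<nu> E + \<eta> E) \<in> games M"
    using assms[THEN AC_inf_games] by (simp add: games_def)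
  ultimately show ?thesis
    unfolding AC_inf_iff using NA_pos_add[OF \<mu>(1) \<mu>'(1)]
    by (intro conjI bexI[of _ "\<lambda>E. \<mu> E + \<mu>' E"]) auto
qed

lemma AC_inf_cmult:
  assumes "\<nu> \<in> AC_inf M"
  shows "(\<lambda>E. c * \<nu> E) \<in> AC_inf M"
proof -
  obtain \<mu> where \<mu>: "\<mu> \<in> NA_pos M"
    "\<And>A C. A \<in> sets M \<Longrightarrow> C \<in> sets M \<Longrightarrow> A \<subseteq> C \<Longrightarrow> \<bar>\<nu> C - \<nu> A\<bar> \<le> \<mu> C - \<mu> A"
    using AC_infE[OF assms] by metis
  have "\<bar>c * \<nu> C - c * \<nu> A\<bar> \<le> \<bar>c\<bar> * \<mu> C - \<bar>c\<bar> * \<mu> A"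
    if "A \<in> sets M" "C \<in> sets M" "A \<subseteq> C" for A C
    using mult_left_mono[OF \<mu>(2)[OF that], of "\<bar>c\<bar>"]
    by (simp add: abs_mult[symmetric] right_diff_distrib)
  moreover have "(\<lambda>E. c * \<nu> E) \<in> games M"
    using AC_inf_games[OF assms] by (simp add: games_def)
  ultimately show ?thesis
    unfolding AC_inf_iff using NA_pos_cmult[OF \<mu>(1), of "\<bar>c\<bar>"]
    by (intro conjI bexI[of _ "\<lambda>E. \<bar>c\<bar> * \<mu> E"]) auto
qed

lemma NA_subset_AC_inf: "NA M \<subseteq> AC_inf M"
proof
  fix \<nu> assume \<nu>: "\<nu> \<in> NA M"
  then obtain \<mu> where \<mu>: "\<mu> \<in> NA_pos M" "\<And>E. E \<in> sets M \<Longrightarrow> \<bar>\<nu> E\<bar> \<le> \<mu> E"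
    using NA_abs_le by metis
  have "\<bar>\<nu> C - \<nu> A\<bar> \<le> \<mu> C - \<mu> A" if "A \<in> sets M" "C \<in> sets M" "A \<subseteq> C" for A C
    using \<mu>(2)[of "C - A"] that finitely_additive_Diff[OF signed_measures_additive, of _ M C A]
      NA_signed[OF \<nu>] NA_pos_signed[OF \<mu>(1)] by simp
  then show "\<nu> \<in> AC_inf M"
    unfolding AC_inf_iff using \<mu>(1) signed_measures_games[OF NA_signed[OF \<nu>]] by blast
qed

lemma BC_integral_NA:
  assumes "\<nu> \<in> BC M" "\<nu> \<in> AC_inf M"
  shows "BC_integral M \<nu> \<in> NA M"
proof -
  obtain \<mu> where \<mu>: "\<mu> \<in> NA_pos M" "\<And>E. E \<in> sets M \<Longrightarrow> \<bar>\<nu> E\<bar> \<le> \<mu> E"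
    using AC_infE[OF assms(2)] by metis
  obtain \<kappa> where \<kappa>: "\<kappa> \<in> NA_pos M" "\<And>E. E \<in> sets M \<Longrightarrow> has_BC_limit M \<kappa> \<nu> E (BC_integral M \<nu> E)"
    using BC_E[OF assms(1)] by metis
  note add = BC_integral_additive[OF assms(1)]
  \<comment> \<open>The value \<open>x\<close> at the empty set satisfies
    \<open>x = x + x\<close>.\<close>
  have "BC_integral M \<nu> {} = 0"
    using finitely_additiveD[OF add, of "{}" "{}"] by simp
  then have games: "BC_integral M \<nu> \<in> games M"
    by (simp add: games_def BC_integral_def)
  show ?thesis
  proof (rule NA_of_dominated[OF games add \<mu>(1)])
    fix E assume E: "E \<in> sets M"
    have "BC_integral M \<nu> E \<le> \<mu> E"
      using \<mu> by (intro has_BC_limit_le[OF \<kappa>(1) E \<kappa>(2)[OF E]] NA_pos_signed) (auto dest: abs_le_D1)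
    moreover have "(-1) * BC_integral M \<nu> E \<le> \<mu> E"
      using \<mu> by (intro has_BC_limit_le[OF \<kappa>(1) E has_BC_limit_cmult[OF \<kappa>(2)[OF E]]] NA_pos_signed)
        (auto dest: abs_le_D2)
    ultimately show "\<bar>BC_integral M \<nu> E\<bar> \<le> \<mu> E"
      by linarith
  qed
qed

section \<open>The upper and lower measures of a game\<close>

text \<open>The case distinction keeps the result a game: \<open>E \<inter> C\<close> may be
  measurable although \<open>E\<close> is not.\<close>

lemma NA_restrict:
  assumes \<mu>: "\<mu> \<in> NA M" and C: "C \<in> sets M"
  shows "(\<lambda>E. if E \<in> sets M then \<mu> (E \<inter> C) else 0) \<in> NA M"
  unfolding NA_iff signed_measures_def games_def
proof (intro conjI CollectI allI impI ballI)
  have sm: "\<mu> \<in> signed_measures M"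
    using \<mu> by (rule NA_signed)
  have 0: "\<mu> {} = 0"
    using sm by (intro gamesD(1)[OF signed_measures_games])
  then show "(if {} \<in> sets M then \<mu> ({} \<inter> C) else 0) = 0"
    by simp
  fix A :: "nat \<Rightarrow> 'a set" assume A: "range A \<subseteq> sets M" "disjoint_family A"
  have "(\<lambda>n. \<mu> (A n \<inter> C)) sums \<mu> (\<Union>n. A n \<inter> C)"
    using A C by (intro signed_measures_sums[OF sm]) (auto simp: disjoint_family_on_def)
  then show "(\<lambda>n. if A n \<in> sets M then \<mu> (A n \<inter> C) else 0) sums
      (if (\<Union>n. A n) \<in> sets M then \<mu> ((\<Union>n. A n) \<inter> C) else 0)"
    using A by (auto simp: image_subset_iff)
next
  fix x assume x: "x \<in> space M"
  have "{x} \<inter> C = {} \<or> {x} \<inter> C = {x}"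
    by auto
  then have "\<mu> ({x} \<inter> C) = 0"
    using \<mu> x gamesD(1)[OF signed_measures_games[OF NA_signed[OF \<mu>]]] unfolding NA_iff by metis
  then show "(if {x} \<in> sets M then \<mu> ({x} \<inter> C) else 0) = 0"
    by simp
qed simp

lemma NA_splice:
  assumes "\<mu> \<in> NA M" "\<mu>' \<in> NA M" and C: "C \<in> sets M"
  shows "(\<lambda>E. if E \<in> sets M then \<mu> (E \<inter> C) + \<mu>' (E - C) else 0) \<in> NA M"
proof -
  have "E \<inter> (space M - C) = E - C" if "E \<in> sets M" for E
    using sets.sets_into_space[OF that] by blast
  then have "(\<lambda>E. if E \<in> sets M then \<mu> (E \<inter> C) + \<mu>' (E - C) else 0) =
    (\<lambda>E. (if E \<in> sets M then \<mu> (E \<inter> C) else 0) + (if E \<in> sets M then \<mu>' (E \<inter> (space M - C)) else 0))"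
    by auto
  then show ?thesis
    using NA_add[OF NA_restrict[OF assms(1) C] NA_restrict[OF assms(2), of "space M - C"]] C by auto
qed

lemma game_le_imp_le:
  assumes "game_le M \<nu> \<eta>" "\<nu> \<in> games M" "\<eta> \<in> games M" "E \<in> sets M"
  shows "\<nu> E \<le> \<eta> E"
proof -
  have "\<eta> {} - \<nu> {} \<le> \<eta> E - \<nu> E"
    using assms(1,4) by (auto simp: game_le_def monotone_game_def)
  then show ?thesis
    using assms(2,3) by (simp add: gamesD(1))
qed

text \<open>
  To pass from \<open>A\<close> to \<open>F\<close> one adds first the part of \<open>F - A\<close> inside \<open>C\<close>, then the part outside.
\<close>

lemma game_le_splice:
  assumes "game_le M \<nu> \<mu>" "\<mu> \<in> NA M" "game_le M \<nu> \<mu>'" "\<mu>' \<in> NA M" and C: "C \<in> sets M"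
  shows "game_le M \<nu> (\<lambda>E. if E \<in> sets M then \<mu> (E \<inter> C) + \<mu>' (E - C) else 0)"
  unfolding game_le_def monotone_game_def
proof (intro ballI impI)
  fix A F assume AF: "A \<in> sets M" "F \<in> sets M" "A \<subseteq> F"
  let ?H = "A \<union> (F \<inter> C)"
  have H: "?H \<in> sets M" "A \<subseteq> ?H" "?H \<subseteq> F"
    using AF C by auto
  have step: "\<nu> Y - \<nu> X \<le> \<eta> Y - \<eta> X" if "game_le M \<nu> \<eta>" "X \<in> sets M" "Y \<in> sets M" "X \<subseteq> Y" for \<eta> X Y
  proof -
    have "\<eta> X - \<nu> X \<le> \<eta> Y - \<nu> Y"
      using that by (auto simp: game_le_def monotone_game_def)
    then show ?thesis
      by linarith
  qed
  have diff: "\<eta> (X - Y) = \<eta> X - \<eta> Y" if "\<eta> \<in> NA M" "X \<in> sets M" "Y \<in> sets M" "Y \<subseteq> X" for \<eta> X Y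
    using finitely_additive_Diff[OF signed_measures_additive[OF NA_signed[OF that(1)]]] that by blast
  have "\<nu> ?H - \<nu> A \<le> \<mu> ?H - \<mu> A"
    using step[OF assms(1)] AF H by blast
  also have "\<dots> = \<mu> (?H - A)"
    using diff[OF assms(2)] AF H by simp
  also have "?H - A = F \<inter> C - A \<inter> C"
    by auto
  also have "\<mu> (F \<inter> C - A \<inter> C) = \<mu> (F \<inter> C) - \<mu> (A \<inter> C)"
    using AF C by (intro diff[OF assms(2)]) auto
  finally have 1: "\<nu> ?H - \<nu> A \<le> \<mu> (F \<inter> C) - \<mu> (A \<inter> C)" .
  have "\<nu> F - \<nu> ?H \<le> \<mu>' F - \<mu>' ?H"
    using step[OF assms(3)] AF H by blast
  also have "\<dots> = \<mu>' (F - ?H)"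
    using diff[OF assms(4)] AF H by simp
  also have "F - ?H = (F - C) - (A - C)"
    by auto
  also have "\<mu>' ((F - C) - (A - C)) = \<mu>' (F - C) - \<mu>' (A - C)"
    using AF C by (intro diff[OF assms(4)]) auto
  finally have 2: "\<nu> F - \<nu> ?H \<le> \<mu>' (F - C) - \<mu>' (A - C)" .
  show "(if A \<in> sets M then \<mu> (A \<inter> C) + \<mu>' (A - C) else 0) - \<nu> A
      \<le> (if F \<in> sets M then \<mu> (F \<inter> C) + \<mu>' (F - C) else 0) - \<nu> F"
    using AF 1 2 by simp
qed

text \<open>A pointwise infimum of measures is in general only superadditive. Here majorants can be
  chosen independently on disjoint sets, which supplies the reverse inequality.\<close>

lemma isGlb_majorants:
  assumes \<nu>: "\<nu> \<in> AC_inf M"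
  shows "\<exists>\<gamma>. isGlb (NA M) {\<eta> \<in> NA M. game_le M \<nu> \<eta>} \<gamma>"
proof -
  define \<Lambda> where "\<Lambda> = {\<eta> \<in> NA M. game_le M \<nu> \<eta>}"
  obtain \<mu> where \<mu>: "\<mu> \<in> NA_pos M"
    "\<And>A C. A \<in> sets M \<Longrightarrow> C \<in> sets M \<Longrightarrow> A \<subseteq> C \<Longrightarrow> \<bar>\<nu> C - \<nu> A\<bar> \<le> \<mu> C - \<mu> A"
    "\<And>E. E \<in> sets M \<Longrightarrow> \<bar>\<nu> E\<bar> \<le> \<mu> E"
    using AC_infE[OF \<nu>] by metis
  have NA: "\<eta> \<in> NA M" "\<eta> \<in> games M" if "\<eta> \<in> \<Lambda>" for \<eta>
    using that signed_measures_games[OF NA_signed] by (auto simp: \<Lambda>_def)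
  have "\<mu> A - \<nu> A \<le> \<mu> C - \<nu> C" if "A \<in> sets M" "C \<in> sets M" "A \<subseteq> C" for A C
    using \<mu>(2)[OF that] by linarith
  then have \<mu>\<Lambda>: "\<mu> \<in> \<Lambda>"
    using \<mu>(1) by (auto simp: \<Lambda>_def game_le_def monotone_game_def NA_pos_def)
  have lower: "- \<mu> E \<le> \<eta> E" if "\<eta> \<in> \<Lambda>" "E \<in> sets M" for \<eta> E
    using game_le_imp_le[of \<nu> \<eta> E] NA(2)[OF that(1)] AC_inf_games[OF \<nu>] \<mu>(3)[of E] that
    by (auto simp: \<Lambda>_def)
  \<comment> \<open>The infimum is finite: \<open>\<mu>\<close> belongs to \<open>\<Lambda>\<close>,
    and every majorant is at least \<open>- \<mu>\<close>. The same two bounds later give the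
    domination by \<open>\<mu>\<close>.\<close>
  define \<gamma> where "\<gamma> E = (if E \<in> sets M then Inf ((\<lambda>\<eta>. \<eta> E) ` \<Lambda>) else 0)" for E
  have \<gamma>_le: "\<gamma> E \<le> \<eta> E" if "\<eta> \<in> \<Lambda>" "E \<in> sets M" for \<eta> E
    using that lower unfolding \<gamma>_def by (auto intro!: cInf_lower bdd_belowI[of _ "- \<mu> E"])
  have \<gamma>_ge: "c \<le> \<gamma> E" if "E \<in> sets M" "\<And>\<eta>. \<eta> \<in> \<Lambda> \<Longrightarrow> c \<le> \<eta> E" for c E
    using that \<mu>\<Lambda> unfolding \<gamma>_def by (auto intro!: cInf_greatest)
  have empty: "\<eta> {} = 0" if "\<eta> \<in> \<Lambda>" for \<eta>
    using gamesD(1)[OF NA(2)[OF that]] .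
  have "\<gamma> {} \<le> 0"
    using \<gamma>_le[OF \<mu>\<Lambda>, of "{}"] empty[OF \<mu>\<Lambda>] by simp
  moreover have "0 \<le> \<gamma> {}"
    by (rule \<gamma>_ge) (auto dest: empty)
  ultimately have "\<gamma> {} = 0"
    by simp
  then have games: "\<gamma> \<in> games M"
    by (simp add: games_def) (simp add: \<gamma>_def)
  have "finitely_additive M \<gamma>"
    unfolding finitely_additive_def
  proof (intro ballI impI)
    fix A C assume AC: "A \<in> sets M" "C \<in> sets M" "A \<inter> C = {}"
    then have AC': "A \<union> C \<in> sets M" "(A \<union> C) \<inter> A = A" "(A \<union> C) - A = C"
      by auto
    show "\<gamma> (A \<union> C) = \<gamma> A + \<gamma> C"
    proof (rule antisym)
      \<comment> \<open>The measure equal to \<open>\<eta>\<close> inside \<open>A\<close> and to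
        \<open>\<eta>'\<close> outside is again a majorant. With \<open>\<eta>\<close> and
        \<open>\<eta>'\<close> unrelated, the infimum is taken over \<open>\<eta>'\<close> first,
        then over \<open>\<eta>\<close>.\<close>
      have bound: "\<gamma> (A \<union> C) - \<eta> A \<le> \<eta>' C" if "\<eta> \<in> \<Lambda>" "\<eta>' \<in> \<Lambda>" for \<eta> \<eta>'
      proof -
        have "(\<lambda>E. if E \<in> sets M then \<eta> (E \<inter> A) + \<eta>' (E - A) else 0) \<in> \<Lambda>"
          using that AC(1) by (auto simp: \<Lambda>_def intro: NA_splice game_le_splice)
        from \<gamma>_le[OF this AC'(1)] show ?thesis
          using AC' by simp
      qed
      have "\<gamma> (A \<union> C) - \<gamma> C \<le> \<eta> A" if "\<eta> \<in> \<Lambda>" for \<eta>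
        using \<gamma>_ge[where E = C and c = "\<gamma> (A \<union> C) - \<eta> A"] AC(2) bound[OF that] by fastforce
      then have "\<gamma> (A \<union> C) - \<gamma> C \<le> \<gamma> A"
        using \<gamma>_ge[where E = A and c = "\<gamma> (A \<union> C) - \<gamma> C"] AC(1) by fastforce
      then show "\<gamma> (A \<union> C) \<le> \<gamma> A + \<gamma> C"
        by simp
      show "\<gamma> A + \<gamma> C \<le> \<gamma> (A \<union> C)"
      proof (rule \<gamma>_ge[OF AC'(1)])
        fix \<eta> assume \<eta>: "\<eta> \<in> \<Lambda>"
        have "\<eta> (A \<union> C) = \<eta> A + \<eta> C"
          using finitely_additiveD[OF signed_measures_additive[OF NA_signed[OF NA(1)[OF \<eta>]]] AC] .
        then show "\<gamma> A + \<gamma> C \<le> \<eta> (A \<union> C)"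
          using \<gamma>_le[OF \<eta>] AC by (simp add: add_mono)
      qed
    qed
  qed
  moreover have "\<bar>\<gamma> E\<bar> \<le> \<mu> E" if "E \<in> sets M" for E
    using \<gamma>_le[OF \<mu>\<Lambda> that] \<gamma>_ge[where E = E and c = "- \<mu> E"] that lower by fastforce
  ultimately have \<gamma>: "\<gamma> \<in> NA M"
    using NA_of_dominated[OF games _ \<mu>(1)] by blast
  have "isGlb (NA M) \<Lambda> \<gamma>"
    unfolding isGlb_def greatestP_def isLb_def setge_def setle_def
    using \<gamma> \<gamma>_le \<gamma>_ge NA(2) signed_measures_games[OF NA_signed]
    by (auto simp: games_le_iff[of _ M])
  then show ?thesis
    unfolding \<Lambda>_def by blast
qed

lemma isGlb_upper_measure:
  assumes "\<nu> \<in> AC_inf M"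
  shows "isGlb (NA M) {\<eta> \<in> NA M. game_le M \<nu> \<eta>} (upper_measure M \<nu>)"
proof -
  obtain \<gamma> where \<gamma>: "isGlb (NA M) {\<eta> \<in> NA M. game_le M \<nu> \<eta>} \<gamma>"
    using isGlb_majorants[OF assms] by blast
  have "upper_measure M \<nu> = \<gamma>"
    unfolding upper_measure_def
    by (rule the_equality, rule \<gamma>) (rule order.antisym[OF isGlb_le_isLb[OF \<gamma> isGlb_isLb] isGlb_le_isLb[OF _ isGlb_isLb[OF \<gamma>]]])
  with \<gamma> show ?thesis
    by simp
qed

text \<open>Negation turns minorants of \<open>\<nu>\<close> into majorants of
  \<open>- \<nu>\<close>, so the least upper bound is minus a greatest lower bound already
  constructed.\<close>

lemma isLub_lower_measure:
  assumes "\<nu> \<in> AC_inf M"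
  shows "isLub (NA M) {\<eta> \<in> NA M. game_le M \<eta> \<nu>} (lower_measure M \<nu>)"
proof -
  let ?\<nu>' = "\<lambda>E. - \<nu> E"
  have "?\<nu>' \<in> AC_inf M"
    using AC_inf_cmult[OF assms, of "-1"] by simp
  then obtain \<gamma> where \<gamma>: "isGlb (NA M) {\<eta> \<in> NA M. game_le M ?\<nu>' \<eta>} \<gamma>"
    using isGlb_majorants by blast
  have neg: "\<eta> \<in> NA M \<and> game_le M \<eta> \<nu> \<longleftrightarrow> (\<lambda>E. - \<eta> E) \<in> NA M \<and> game_le M ?\<nu>' (\<lambda>E. - \<eta> E)" for \<eta>
  proof -
    have "\<eta> \<in> NA M \<longleftrightarrow> (\<lambda>E. - \<eta> E) \<in> NA M"
      using NA_uminus[of \<eta>] NA_uminus[of "\<lambda>E. - \<eta> E"] by auto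
    then show ?thesis
      by (simp add: game_le_def)
  qed
  have le_neg: "\<eta> \<le> (\<lambda>E. - \<gamma> E) \<longleftrightarrow> \<gamma> \<le> (\<lambda>E. - \<eta> E)" "(\<lambda>E. - \<gamma> E) \<le> \<eta> \<longleftrightarrow> (\<lambda>E. - \<eta> E) \<le> \<gamma>" for \<eta>
    unfolding le_fun_def by (metis le_minus_iff, metis minus_le_iff)
  have lub: "isLub (NA M) {\<eta> \<in> NA M. game_le M \<eta> \<nu>} (\<lambda>E. - \<gamma> E)"
  proof (rule isLubI2)
    show "isUb (NA M) {\<eta> \<in> NA M. game_le M \<eta> \<nu>} (\<lambda>E. - \<gamma> E)"
    proof (rule isUbI)
      show "(\<lambda>E. - \<gamma> E) \<in> NA M"
        using isGlbD1a[OF \<gamma>] by (rule NA_uminus)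
      show "{\<eta> \<in> NA M. game_le M \<eta> \<nu>} *<= (\<lambda>E. - \<gamma> E)"
        using neg isGlbD1[OF \<gamma>] by (intro setleI) (auto simp: le_neg setge_def)
    qed
    show "(\<lambda>E. - \<gamma> E) <=* Collect (isUb (NA M) {\<eta> \<in> NA M. game_le M \<eta> \<nu>})"
    proof (intro setgeI ballI)
      fix \<beta> assume "\<beta> \<in> Collect (isUb (NA M) {\<eta> \<in> NA M. game_le M \<eta> \<nu>})"
      then have \<beta>: "\<beta> \<in> NA M" "\<And>\<eta>. \<eta> \<in> NA M \<Longrightarrow> game_le M \<eta> \<nu> \<Longrightarrow> \<eta> \<le> \<beta>"
        by (auto simp: isUb_def setle_def)
      have "isLb (NA M) {\<eta> \<in> NA M. game_le M ?\<nu>' \<eta>} (\<lambda>E. - \<beta> E)"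
        unfolding isLb_def
      proof (intro conjI setgeI ballI)
        show "(\<lambda>E. - \<beta> E) \<in> NA M"
          using \<beta>(1) by (rule NA_uminus)
        fix \<eta> assume "\<eta> \<in> {\<eta> \<in> NA M. game_le M ?\<nu>' \<eta>}"
        then have "(\<lambda>E. - \<eta> E) \<le> \<beta>"
          using neg[of "\<lambda>E. - \<eta> E"] by (intro \<beta>(2)) auto
        then show "(\<lambda>E. - \<beta> E) \<le> \<eta>"
          unfolding le_fun_def by (metis minus_le_iff)
      qed
      then show "(\<lambda>E. - \<gamma> E) \<le> \<beta>"
        unfolding le_neg by (rule isGlb_le_isLb[OF \<gamma>])
    qed
  qed
  have "lower_measure M \<nu> = (\<lambda>E. - \<gamma> E)"
    unfolding lower_measure_def
    by (rule the_equality, rule lub) (rule order.antisym[OF isLub_le_isUb[OF _ isLub_isUb[OF lub]] isLub_le_isUb[OF lub isLub_isUb]])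
  with lub show ?thesis
    by simp
qed

lemma BC_integral_between:
  assumes "\<nu> \<in> BC M" "\<nu> \<in> AC_inf M"
  shows "lower_measure M \<nu> \<le> BC_integral M \<nu>" "BC_integral M \<nu> \<le> upper_measure M \<nu>"
proof -
  obtain \<kappa> where \<kappa>: "\<kappa> \<in> NA_pos M" "\<And>E. E \<in> sets M \<Longrightarrow> has_BC_limit M \<kappa> \<nu> E (BC_integral M \<nu> E)"
    using BC_E[OF assms(1)] by metis
  have NA: "BC_integral M \<nu> \<in> NA M"
    by (rule BC_integral_NA[OF assms])
  have games: "\<eta> \<in> games M" if "\<eta> \<in> NA M" for \<eta>
    using signed_measures_games[OF NA_signed[OF that]] .
  have "BC_integral M \<nu> \<le> \<eta>" if \<eta>: "\<eta> \<in> NA M" "game_le M \<nu> \<eta>" for \<eta>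
    unfolding games_le_iff[OF games[OF NA] games[OF \<eta>(1)]]
  proof
    fix E assume E: "E \<in> sets M"
    show "BC_integral M \<nu> E \<le> \<eta> E"
      using game_le_imp_le[OF \<eta>(2) AC_inf_games[OF assms(2)] games[OF \<eta>(1)]]
      by (intro has_BC_limit_le[OF \<kappa>(1) E \<kappa>(2)[OF E] NA_signed[OF \<eta>(1)]])
  qed
  then have "isLb (NA M) {\<eta> \<in> NA M. game_le M \<nu> \<eta>} (BC_integral M \<nu>)"
    using NA by (auto simp: isLb_def setge_def)
  then show "BC_integral M \<nu> \<le> upper_measure M \<nu>"
    by (rule isGlb_le_isLb[OF isGlb_upper_measure[OF assms(2)]])
  have "\<eta> \<le> BC_integral M \<nu>" if \<eta>: "\<eta> \<in> NA M" "game_le M \<eta> \<nu>" for \<eta>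
    unfolding games_le_iff[OF games[OF \<eta>(1)] games[OF NA]]
  proof
    fix E assume E: "E \<in> sets M"
    \<comment> \<open>Comparison with measures is available only from above, so the minorant is
      handled after a change of sign.\<close>
    have "(-1) * BC_integral M \<nu> E \<le> - \<eta> E"
      using game_le_imp_le[OF \<eta>(2) games[OF \<eta>(1)] AC_inf_games[OF assms(2)]]
      by (intro has_BC_limit_le[OF \<kappa>(1) E has_BC_limit_cmult[OF \<kappa>(2)[OF E]] NA_signed[OF NA_uminus[OF \<eta>(1)]]])
        simp
    then show "\<eta> E \<le> BC_integral M \<nu> E"
      by simp
  qed
  then have "isUb (NA M) {\<eta> \<in> NA M. game_le M \<eta> \<nu>} (BC_integral M \<nu>)"
    using NA by (auto simp: isUb_def setle_def)
  then show "lower_measure M \<nu> \<le> BC_integral M \<nu>"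
    by (rule isLub_le_isUb[OF isLub_lower_measure[OF assms(2)]])
qed

end

section \<open>Automorphisms\<close>

context
  fixes M :: "'a measure" and \<theta> :: "'a \<Rightarrow> 'a"
  assumes \<theta>: "\<theta> \<in> automorphisms M"
begin

lemma automorphism_bij: "bij_betw \<theta> (space M) (space M)"
  using \<theta> by (simp add: automorphisms_def)

lemma automorphism_inj: "inj_on \<theta> (space M)"
  using automorphism_bij by (rule bij_betw_imp_inj_on)

text \<open>\<open>game_transform\<close> evaluates games on images; these are preimages under the
  inverse, which is measurable.\<close>

lemma automorphism_image_sets:
  assumes E: "E \<in> sets M"
  shows "\<theta> ` E \<in> sets M"
proof -
  have sub: "E \<subseteq> space M"
    using E by (rule sets.sets_into_space)
  have "\<theta> ` E = the_inv_into (space M) \<theta> -` E \<inter> space M"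
  proof (intro equalityI subsetI)
    fix y assume "y \<in> \<theta> ` E"
    then show "y \<in> the_inv_into (space M) \<theta> -` E \<inter> space M"
      using sub automorphism_bij by (auto simp: the_inv_into_f_f[OF automorphism_inj] bij_betw_def)
  next
    fix y assume y: "y \<in> the_inv_into (space M) \<theta> -` E \<inter> space M"
    then have "\<theta> (the_inv_into (space M) \<theta> y) = y"
      using automorphism_bij by (intro f_the_inv_into_f_bij_betw) auto
    then show "y \<in> \<theta> ` E"
      using y by (metis IntD1 imageI vimageD)
  qed
  also have "\<dots> \<in> sets M"
    using \<theta> E by (auto simp: automorphisms_def intro: measurable_sets)
  finally show ?thesis .
qed

lemma game_transform_games: "\<nu> \<in> games M \<Longrightarrow> game_transform M \<theta> \<nu> \<in> games M"
  by (simp add: games_def game_transform_def)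

lemma game_transform_signed_measures:
  assumes \<mu>: "\<mu> \<in> signed_measures M"
  shows "game_transform M \<theta> \<mu> \<in> signed_measures M"
  unfolding signed_measures_def
proof (intro CollectI conjI allI impI)
  show "game_transform M \<theta> \<mu> \<in> games M"
    using \<mu> by (intro game_transform_games signed_measures_games)
  fix A :: "nat \<Rightarrow> 'a set" assume A: "range A \<subseteq> sets M" "disjoint_family A"
  have sub: "A n \<subseteq> space M" for n
    using A(1) sets.sets_into_space by blast
  have "\<theta> ` A m \<inter> \<theta> ` A n = {}" if "m \<noteq> n" for m n
    using inj_on_image_Int[OF automorphism_inj sub sub, of m n] A(2) that
    by (auto simp: disjoint_family_on_def)
  then have "(\<lambda>n. \<mu> (\<theta> ` A n)) sums \<mu> (\<Union>n. \<theta> ` A n)"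
    using A(1) automorphism_image_sets
    by (intro signed_measures_sums[OF \<mu>]) (auto simp: disjoint_family_on_def)
  moreover have "A n \<in> sets M" for n
    using A(1) by blast
  ultimately show "(\<lambda>n. game_transform M \<theta> \<mu> (A n)) sums game_transform M \<theta> \<mu> (\<Union>n. A n)"
    using A(1) by (simp add: game_transform_def image_UN)
qed

lemma has_BC_limit_transform:
  assumes E: "E \<in> sets M" and lim: "has_BC_limit M \<kappa> \<nu> (\<theta> ` E) l"
  shows "has_BC_limit M (game_transform M \<theta> \<kappa>) (game_transform M \<theta> \<nu>) E l"
  unfolding has_BC_limit_def
proof (intro allI impI)
  fix \<epsilon> :: real assume "0 < \<epsilon>"
  then obtain \<delta> where \<delta>: "0 < \<delta>"
    "\<And>D. D \<in> partitions M (\<theta> ` E) \<Longrightarrow> mesh \<kappa> D < \<delta> \<Longrightarrow> \<bar>(\<Sum>I\<in>D. \<nu> I) - l\<bar> < \<epsilon>"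
    using lim unfolding has_BC_limit_def by metis
  have "\<bar>(\<Sum>I\<in>D. game_transform M \<theta> \<nu> I) - l\<bar> < \<epsilon>"
    if D: "D \<in> partitions M E" and mesh: "mesh (game_transform M \<theta> \<kappa>) D < \<delta>" for D
  proof -
    let ?D = "(`) \<theta> ` D"
    have inj: "inj_on \<theta> E"
      using automorphism_inj sets.sets_into_space[OF E] by (rule inj_on_subset)
    have "partition_on E D"
      using D by (simp add: partitions_def)
    then have "partition_on (\<theta> ` E) (?D - {{}})"
      using inj by (rule partition_on_inj_image)
    moreover have "{} \<notin> ?D"
      using partitionsD(6)[OF D] by auto
    ultimately have "partition_on (\<theta> ` E) ?D"
      by simp
    then have "?D \<in> partitions M (\<theta> ` E)"
      using D automorphism_image_sets by (auto simp: partitions_def)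
    moreover have "game_transform M \<theta> \<kappa> ` D = \<kappa> ` ?D"
      using partitionsD(2)[OF D] by (force simp: game_transform_def)
    then have "mesh \<kappa> ?D < \<delta>"
      using mesh by (simp add: mesh_def)
    ultimately have "\<bar>(\<Sum>I\<in>?D. \<nu> I) - l\<bar> < \<epsilon>"
      by (rule \<delta>(2))
    \<comment> \<open>Distinct cells have distinct images, so no term is lost in the
      reindexing.\<close>
    moreover have "inj_on ((`) \<theta>) D"
      using inj partitionsD(3)[OF D] by (intro inj_onI) (metis inj_on_image_eq_iff)
    then have "(\<Sum>I\<in>?D. \<nu> I) = (\<Sum>I\<in>D. game_transform M \<theta> \<nu> I)"
      using partitionsD(2)[OF D] by (simp add: sum.reindex game_transform_def)
    ultimately show ?thesis
      by simp
  qed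
  then show "\<exists>\<delta>>0. \<forall>D\<in>partitions M E. mesh (game_transform M \<theta> \<kappa>) D < \<delta> \<longrightarrow>
      \<bar>(\<Sum>I\<in>D. game_transform M \<theta> \<nu> I) - l\<bar> < \<epsilon>"
    using \<delta>(1) by blast
qed

end

context countably_separated
begin

section \<open>Symmetry and positivity of the integral\<close>

lemma game_transform_NA_pos:
  assumes \<theta>: "\<theta> \<in> automorphisms M" and \<mu>: "\<mu> \<in> NA_pos M"
  shows "game_transform M \<theta> \<mu> \<in> NA_pos M"
proof -
  have "game_transform M \<theta> \<mu> {x} = 0" if "x \<in> space M" for x
  proof -
    have "\<theta> x \<in> space M"
      using automorphism_bij[OF \<theta>] that by (auto simp: bij_betw_def)
    then show ?thesis
      using \<mu> by (simp add: game_transform_def NA_pos_def NA_iff)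
  qed
  moreover have "0 \<le> game_transform M \<theta> \<mu> E" if "E \<in> sets M" for E
    using \<mu> that automorphism_image_sets[OF \<theta>] by (simp add: game_transform_def NA_pos_def)
  ultimately show ?thesis
    using game_transform_signed_measures[OF \<theta> NA_pos_signed[OF \<mu>]] by (simp add: NA_pos_def NA_iff)
qed

lemma game_transform_AC_inf:
  assumes \<theta>: "\<theta> \<in> automorphisms M" and \<nu>: "\<nu> \<in> AC_inf M"
  shows "game_transform M \<theta> \<nu> \<in> AC_inf M"
proof -
  obtain \<mu> where \<mu>: "\<mu> \<in> NA_pos M"
    "\<And>A C. A \<in> sets M \<Longrightarrow> C \<in> sets M \<Longrightarrow> A \<subseteq> C \<Longrightarrow> \<bar>\<nu> C - \<nu> A\<bar> \<le> \<mu> C - \<mu> A"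
    using AC_infE[OF \<nu>] by metis
  show ?thesis
    unfolding AC_inf_iff
  proof (intro conjI bexI ballI impI)
    show "game_transform M \<theta> \<nu> \<in> games M"
      using AC_inf_games[OF \<nu>] by (rule game_transform_games[OF \<theta>])
    show "game_transform M \<theta> \<mu> \<in> NA_pos M"
      by (rule game_transform_NA_pos[OF \<theta> \<mu>(1)])
    fix A C assume AC: "A \<in> sets M" "C \<in> sets M" "A \<subseteq> C"
    show "\<bar>game_transform M \<theta> \<nu> C - game_transform M \<theta> \<nu> A\<bar>
        \<le> game_transform M \<theta> \<mu> C - game_transform M \<theta> \<mu> A"
      using \<mu>(2)[of "\<theta> ` A" "\<theta> ` C"] AC automorphism_image_sets[OF \<theta>]
      by (simp add: game_transform_def image_mono)
  qed
qed

text \<open>The limit is computed with the transported control; independence of the control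
  identifies it with the integral of the transformed game.\<close>

lemma game_transform_BC:
  assumes \<theta>: "\<theta> \<in> automorphisms M" and \<nu>: "\<nu> \<in> BC M"
  shows "game_transform M \<theta> \<nu> \<in> BC M"
    and "BC_integral M (game_transform M \<theta> \<nu>) = game_transform M \<theta> (BC_integral M \<nu>)"
proof -
  obtain \<kappa> where \<kappa>: "\<kappa> \<in> NA_pos M" "\<And>E. E \<in> sets M \<Longrightarrow> has_BC_limit M \<kappa> \<nu> E (BC_integral M \<nu> E)"
    using BC_E[OF \<nu>] by metis
  have lim: "has_BC_limit M (game_transform M \<theta> \<kappa>) (game_transform M \<theta> \<nu>) E
      (game_transform M \<theta> (BC_integral M \<nu>) E)" if E: "E \<in> sets M" for E
    using has_BC_limit_transform[OF \<theta> E \<kappa>(2)[OF automorphism_image_sets[OF \<theta> E]]] E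
    by (simp add: game_transform_def)
  have "\<nu> \<in> games M"
    using \<nu> by (simp add: BC_def)
  then show "game_transform M \<theta> \<nu> \<in> BC M"
    by (intro BC_I[OF _ game_transform_NA_pos[OF \<theta> \<kappa>(1)] lim] game_transform_games[OF \<theta>])
  show "BC_integral M (game_transform M \<theta> \<nu>) = game_transform M \<theta> (BC_integral M \<nu>)"
    by (rule BC_integral_eq[OF game_transform_NA_pos[OF \<theta> \<kappa>(1)] lim]) (simp_all add: game_transform_def)
qed

lemma BC_integral_nonneg:
  assumes \<nu>: "\<nu> \<in> BC M" and mono: "monotone_game M \<nu>" and E: "E \<in> sets M"
  shows "0 \<le> BC_integral M \<nu> E"
proof -
  obtain \<kappa> where \<kappa>: "\<kappa> \<in> NA_pos M" "\<And>E. E \<in> sets M \<Longrightarrow> has_BC_limit M \<kappa> \<nu> E (BC_integral M \<nu> E)"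
    using BC_E[OF \<nu>] by metis
  have "\<nu> {} = 0"
    using \<nu> by (simp add: BC_def games_def)
  then have "0 \<le> \<nu> I" if "I \<in> sets M" for I
    using mono that unfolding monotone_game_def by (metis empty_subsetI sets.empty_sets)
  then have "0 \<le> (\<Sum>I\<in>D. \<nu> I)" if "D \<in> partitions M E" for D
    using partitionsD(2)[OF that] by (simp add: sum_nonneg)
  then show ?thesis
    by (rule has_BC_limit_lower_bound[OF \<kappa>(1) E \<kappa>(2)[OF E]])
qed

section \<open>The integral as an operator on Lipschitz integrable games\<close>

lemma game_subspace_BC_AC_inf: "game_subspace (BC M \<inter> AC_inf M)"
proof -
  have "(\<lambda>E. 0) \<in> NA M"
    using NA_pos_zero by (simp add: NA_pos_def)
  then have "(\<lambda>E. 0) \<in> BC M \<inter> AC_inf M"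
    using NA_subset_AC_inf BC_measure(1)[OF NA_signed] by blast
  then show ?thesis
    by (auto simp: game_subspace_def intro: BC_add BC_cmult AC_inf_add AC_inf_cmult)
qed

lemma linear_BC_integral: "linear_to_NA M (BC M \<inter> AC_inf M) (BC_integral M)"
  by (auto simp: linear_to_NA_def BC_integral_NA BC_add BC_cmult)

lemma Milnor_operator_BC_integral: "Milnor_operator M (BC M \<inter> AC_inf M) (BC_integral M)"
  unfolding Milnor_operator_def
  using game_subspace_BC_AC_inf linear_BC_integral NA_subset_AC_inf BC_measure(1)[OF NA_signed]
    BC_integral_between by auto

lemma semivalue_BC_integral: "semivalue M (BC M \<inter> AC_inf M) (BC_integral M)"
  unfolding semivalue_def symmetric_subspace_def
  using game_subspace_BC_AC_inf linear_BC_integral game_transform_BC game_transform_AC_inf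
    BC_integral_nonneg BC_measure(2)[OF NA_signed]
  by (auto simp: AC_inf_def)

end

theorem proposition4p3:
  fixes M :: "'a measure"
  assumes "standard_borel_space M"
  shows "Milnor_operator M (BC M \<inter> AC_inf M) (BC_integral M) \<and>
         semivalue M (BC M \<inter> AC_inf M) (BC_integral M)"
  using standard_borel_countably_separated[OF assms]
    countably_separated.Milnor_operator_BC_integral countably_separated.semivalue_BC_integral
  by blast

end
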